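(* Let $A\in L^q(D,\mathbb{B})$ with $q>2$, and let $w\in H_{A,0}(D,\mathbb{B})$, written as $w=\varphi e^{\phi}$ with $\phi=T_{\mathbb{B}}(A)$ and $\varphi\in Hol(D,\mathbb{B})$. Then the factor $\varphi$ has a boundary value in the sense of distributions $\varphi_b$ if and only if there exist constants $C>0$ and $\alpha\ge 0$ such that $$\|w(re^{i\theta})\|_{\mathbb{B}}\le\frac{C}{(1-r)^\alpha}$$ for all $re^{i\theta}\in D$.
   Context: $D$ is the open unit disk in $\mathbb{C}$, $\partial D$ the unit circle. For $u\in\mathbb{C}$, $u^*$ denotes the complex conjugate; $\frac{\partial}{\partial z}=\frac12(\partial_x-i\partial_y)$, $\frac{\partial}{\partial z^*}=\frac12(\partial_x+i\partial_y)$. $\mathbb{B}$ denotes the bicomplex numbers: the commutative $\mathbb{C}$-algebra of elements $z_1+jz_2$ with $z_1,z_2\in\mathbb{C}$, $j^2=-1$, $ij=ji$. Put $p^\pm=\frac12(1\pm ij)$ (idempotents with $p^+p^-=0$). Each $w=z_1+jz_2\in\mathbb{B}$ is uniquely $w=p^+w^++p^-w^-$ with $w^\pm=z_1\mp iz_2\in\mathbb{C}$; for functions, $f^\pm$ is defined pointwise. $\|w\|_{\mathbb{B}}=\sqrt{(|w^+|^2+|w^-|^2)/2}$ and $e^w=p^+e^{w^+}+p^-e^{w^-}$. $L^q(D,\mathbb{B})$ is the set of $f:D\to\mathbb{B}$ with $\iint_D\|f\|_{\mathbb{B}}^q\,dx\,dy<\infty$. $\bar\partial=\frac12(\partial_x+j\partial_y)=p^+\frac{\partial}{\partial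 z}+p^-\frac{\partial}{\partial z^*}$, derivatives in the weak sense. $Hol(D,\mathbb{B})$ is the set of $f:D\to\mathbb{B}$ with $\bar\partial f=0$, equivalently with $(f^+)^*$ and $f^-$ ordinary holomorphic functions. $H_{A,0}(D,\mathbb{B})$ is the set of $f:D\to\mathbb{B}$ with $\bar\partial f=Af$. The bicomplex Theodorescu operator is $$T_{\mathbb{B}}(g)(z)=p^+\left(-\frac1\pi\iint_D\frac{g^+(\zeta)}{\zeta^*-z^*}\,d\xi\,d\eta\right)+p^-\left(-\frac1\pi\iint_D\frac{g^-(\zeta)}{\zeta-z}\,d\xi\,d\eta\right),\quad \zeta=\xi+i\eta.$$ It is known that every $w\in H_{A,0}(D,\mathbb{B})$ can be written $w=\varphi e^{T_{\mathbb{B}}(A)}$ with $\varphi\in Hol(D,\mathbb{B})$; $w$ is identified with this continuous representative. A function $f:D\to\mathbb{B}$ has a boundary value in the sense of distributions $f_b$ if for every $\psi\in C^\infty(\partial D)$ (complex-valued, regarded as a $2\pi$-periodic function of $\theta$) the limit $\langle f_b,\psi\rangle:=\lim_{r\nearrow1}\int_0^{2\pi}f(re^{i\theta})\psi(\theta)\,d\theta$ exists. *)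

theory Defs
  imports "HOL-Analysis.Analysis"
begin

section \<open>Bicomplex numbers\<close>

text \<open>\<open>Bicomplex z1 z2\<close> stands for \<open>z1 + j z2\<close>.\<close>

datatype bicomplex = Bicomplex (bc1: complex) (bc2: complex)

lemma bicomplex_eq_iff: "u = v \<longleftrightarrow> bc1 u = bc1 v \<and> bc2 u = bc2 v"
  by (cases u; cases v) auto

instantiation bicomplex :: comm_ring_1
begin

definition zero_bicomplex :: bicomplex where "0 = Bicomplex 0 0"
definition one_bicomplex :: bicomplex where "1 = Bicomplex 1 0"
definition plus_bicomplex :: "bicomplex \<Rightarrow> bicomplex \<Rightarrow> bicomplex" where
  "u + v = Bicomplex (bc1 u + bc1 v) (bc2 u + bc2 v)"
definition uminus_bicomplex :: "bicomplex \<Rightarrow> bicomplex" where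
  "- u = Bicomplex (- bc1 u) (- bc2 u)"
definition minus_bicomplex :: "bicomplex \<Rightarrow> bicomplex \<Rightarrow> bicomplex" where
  "u - v = Bicomplex (bc1 u - bc1 v) (bc2 u - bc2 v)"
definition times_bicomplex :: "bicomplex \<Rightarrow> bicomplex \<Rightarrow> bicomplex" where
  "u * v = Bicomplex (bc1 u * bc1 v - bc2 u * bc2 v) (bc1 u * bc2 v + bc2 u * bc1 v)"

instance
  by standard
    (auto simp: zero_bicomplex_def one_bicomplex_def plus_bicomplex_def uminus_bicomplex_def
      minus_bicomplex_def times_bicomplex_def bicomplex_eq_iff algebra_simps)

end

lemma bc_sel_simps [simp]:
  "bc1 0 = 0" "bc2 0 = 0" "bc1 1 = 1" "bc2 1 = 0"
  "bc1 (u + v) = bc1 u + bc1 v" "bc2 (u + v) = bc2 u + bc2 v"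
  "bc1 (- u) = - bc1 u" "bc2 (- u) = - bc2 u"
  "bc1 (u - v) = bc1 u - bc1 v" "bc2 (u - v) = bc2 u - bc2 v"
  "bc1 (u * v) = bc1 u * bc1 v - bc2 u * bc2 v"
  "bc2 (u * v) = bc1 u * bc2 v + bc2 u * bc1 v"
  by (simp_all add: zero_bicomplex_def one_bicomplex_def plus_bicomplex_def uminus_bicomplex_def
      minus_bicomplex_def times_bicomplex_def)

definition bc_of_complex :: "complex \<Rightarrow> bicomplex" where
  "bc_of_complex z = Bicomplex z 0"

definition bc_j :: bicomplex where
  "bc_j = Bicomplex 0 1"

definition bc_plus :: "bicomplex \<Rightarrow> complex" where
  "bc_plus w = bc1 w - \<i> * bc2 w"

definition bc_minus :: "bicomplex \<Rightarrow> complex" where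
  "bc_minus w = bc1 w + \<i> * bc2 w"

text \<open>The idempotents \<open>(1 + i j) / 2\<close> and \<open>(1 - i j) / 2\<close>.\<close>

definition p_plus :: bicomplex where
  "p_plus = bc_of_complex (1/2) * (1 + bc_of_complex \<i> * bc_j)"

definition p_minus :: bicomplex where
  "p_minus = bc_of_complex (1/2) * (1 - bc_of_complex \<i> * bc_j)"

lemma p_plus_minus_coordinates:
  "p_plus = Bicomplex (1/2) (\<i>/2)" "p_minus = Bicomplex (1/2) (- \<i>/2)"
  by (simp_all add: p_plus_def p_minus_def bc_of_complex_def bc_j_def bicomplex_eq_iff)

lemma p_idempotents:
  "p_plus * p_plus = p_plus" "p_minus * p_minus = p_minus" "p_plus * p_minus = 0"
  by (simp_all add: p_plus_minus_coordinates bicomplex_eq_iff)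

lemma bicomplex_decomposition:
  "w = p_plus * bc_of_complex a + p_minus * bc_of_complex b \<longleftrightarrow> a = bc_plus w \<and> b = bc_minus w"
  by (auto simp: p_plus_minus_coordinates bc_of_complex_def bc_plus_def bc_minus_def
      bicomplex_eq_iff complex_eq_iff field_simps)

definition bc_exp :: "bicomplex \<Rightarrow> bicomplex" where
  "bc_exp w = p_plus * bc_of_complex (exp (bc_plus w)) + p_minus * bc_of_complex (exp (bc_minus w))"

text \<open>
  The bicomplex norm is Euclidean (it equals the square root of
  \<open>(cmod (bc1 w))\<^sup>2 + (cmod (bc2 w))\<^sup>2\<close>), which makes Bochner integration of bicomplex-valued
  functions available. It is not submultiplicative, so the library's \<open>exp\<close> does not apply.
\<close>

instantiation bicomplex :: real_inner
begin

definition scaleR_bicomplex :: "real \<Rightarrow> bicomplex \<Rightarrow> bicomplex" where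
  "r *\<^sub>R w = Bicomplex (r *\<^sub>R bc1 w) (r *\<^sub>R bc2 w)"
definition norm_bicomplex :: "bicomplex \<Rightarrow> real" where
  "norm w = sqrt (((cmod (bc_plus w))\<^sup>2 + (cmod (bc_minus w))\<^sup>2) / 2)"
definition inner_bicomplex :: "bicomplex \<Rightarrow> bicomplex \<Rightarrow> real" where
  "inner u v = inner (bc1 u) (bc1 v) + inner (bc2 u) (bc2 v)"
definition sgn_bicomplex :: "bicomplex \<Rightarrow> bicomplex" where
  "sgn (w::bicomplex) = inverse (norm w) *\<^sub>R w"
definition dist_bicomplex :: "bicomplex \<Rightarrow> bicomplex \<Rightarrow> real" where
  "dist (u::bicomplex) v = norm (u - v)"
definition uniformity_bicomplex :: "(bicomplex \<times> bicomplex) filter" where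
  "uniformity = (INF e\<in>{0 <..}. principal {(u::bicomplex, v). dist u v < e})"
definition open_bicomplex :: "bicomplex set \<Rightarrow> bool" where
  "open (U::bicomplex set) \<longleftrightarrow> (\<forall>x\<in>U. \<forall>\<^sub>F (x', y) in uniformity. x' = x \<longrightarrow> y \<in> U)"

instance
proof
  fix r s :: real and u v w :: bicomplex and U :: "bicomplex set"
  show "r *\<^sub>R (u + v) = r *\<^sub>R u + r *\<^sub>R v" "(r + s) *\<^sub>R u = r *\<^sub>R u + s *\<^sub>R u"
    "r *\<^sub>R s *\<^sub>R u = (r * s) *\<^sub>R u" "1 *\<^sub>R u = u"
    by (simp_all add: scaleR_bicomplex_def bicomplex_eq_iff algebra_simps)
  show "dist u v = norm (u - v)" by (rule dist_bicomplex_def)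
  show "sgn u = inverse (norm u) *\<^sub>R u" by (rule sgn_bicomplex_def)
  show "uniformity = (INF e\<in>{0 <..}. principal {(u, v::bicomplex). dist u v < e})"
    by (rule uniformity_bicomplex_def)
  show "open U \<longleftrightarrow> (\<forall>x\<in>U. \<forall>\<^sub>F (x', y) in uniformity. x' = x \<longrightarrow> y \<in> U)"
    by (rule open_bicomplex_def)
  show "inner u v = inner v u" by (simp add: inner_bicomplex_def inner_commute)
  show "inner (u + v) w = inner u w + inner v w"
    by (simp add: inner_bicomplex_def inner_add_left)
  show "inner (r *\<^sub>R u) v = r * inner u v"
    by (simp add: inner_bicomplex_def scaleR_bicomplex_def algebra_simps)
  show "0 \<le> inner u u" by (simp add: inner_bicomplex_def)
  show "inner u u = 0 \<longleftrightarrow> u = 0"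
    by (simp add: inner_bicomplex_def bicomplex_eq_iff add_nonneg_eq_0_iff)
  show "norm u = sqrt (inner u u)"
  proof -
    have "((cmod (bc_plus u))\<^sup>2 + (cmod (bc_minus u))\<^sup>2) / 2 = inner u u"
      unfolding norm_bicomplex_def inner_bicomplex_def bc_plus_def bc_minus_def cmod_power2
        inner_complex_def by (simp add: power2_eq_square) (simp add: field_simps)
    then show ?thesis by (simp add: norm_bicomplex_def)
  qed
qed

end

instantiation bicomplex :: euclidean_space
begin

definition Basis_bicomplex :: "bicomplex set" where
  "Basis = {Bicomplex 1 0, Bicomplex \<i> 0, Bicomplex 0 1, Bicomplex 0 \<i>}"

instance
proof
  show "(Basis :: bicomplex set) \<noteq> {}" "finite (Basis :: bicomplex set)"
    by (simp_all add: Basis_bicomplex_def)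
  show "inner u v = (if u = v then 1 else 0)" if "u \<in> Basis" "v \<in> Basis" for u v :: bicomplex
    using that unfolding Basis_bicomplex_def
    by (elim insertE emptyE) (simp_all add: inner_bicomplex_def)
  show "(\<forall>u\<in>Basis. inner x u = 0) \<longleftrightarrow> x = 0" for x :: bicomplex
    by (simp add: Basis_bicomplex_def inner_bicomplex_def bicomplex_eq_iff complex_eq_iff conj_assoc)
qed

end

section \<open>Function spaces on the unit disc\<close>

abbreviation unit_disc :: "complex set" where
  "unit_disc \<equiv> ball 0 1"

text \<open>Functions on the disc are total functions whose values off \<open>unit_disc\<close> are irrelevant.\<close>

definition Lq_disc :: "real \<Rightarrow> (complex \<Rightarrow> bicomplex) set" where
  "Lq_disc q = {f. set_borel_measurable lebesgue unit_disc f \<and>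
                   set_integrable lebesgue unit_disc (\<lambda>z. norm (f z) powr q)}"

definition locally_integrable_disc :: "(complex \<Rightarrow> bicomplex) \<Rightarrow> bool" where
  "locally_integrable_disc f \<longleftrightarrow>
     (\<forall>K. compact K \<and> K \<subseteq> unit_disc \<longrightarrow> set_integrable lebesgue K f)"

text \<open>\<open>d m n\<close> is the partial derivative of order \<open>m\<close> in \<open>x\<close> and order \<open>n\<close> in \<open>y\<close>.\<close>

definition smooth_plane :: "(complex \<Rightarrow> complex) \<Rightarrow> bool" where
  "smooth_plane \<psi> \<longleftrightarrow> (\<exists>d :: nat \<Rightarrow> nat \<Rightarrow> complex \<Rightarrow> complex. d 0 0 = \<psi> \<and>
     (\<forall>m n z. (d m n has_derivative
        (\<lambda>h. Re h *\<^sub>R d (Suc m) n z + Im h *\<^sub>R d m (Suc n) z)) (at z)))"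

definition test_functions :: "(complex \<Rightarrow> complex) set" where
  "test_functions = {\<psi>. smooth_plane \<psi> \<and> compact (closure {z. \<psi> z \<noteq> 0}) \<and>
                        closure {z. \<psi> z \<noteq> 0} \<subseteq> unit_disc}"

text \<open>The operator \<open>(\<partial>\<^sub>x + j \<partial>\<^sub>y) / 2\<close> on differentiable complex-valued functions.\<close>

definition dbar :: "(complex \<Rightarrow> complex) \<Rightarrow> complex \<Rightarrow> bicomplex" where
  "dbar \<psi> z = bc_of_complex (1/2) *
     (bc_of_complex (frechet_derivative \<psi> (at z) 1) +
      bc_j * bc_of_complex (frechet_derivative \<psi> (at z) \<i>))"

text \<open>\<open>g\<close> is the weak \<open>dbar\<close>-derivative of \<open>f\<close> in the disc.\<close>

definition has_weak_dbar :: "(complex \<Rightarrow> bicomplex) \<Rightarrow> (complex \<Rightarrow> bicomplex) \<Rightarrow> bool" where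
  "has_weak_dbar f g \<longleftrightarrow> locally_integrable_disc f \<and> locally_integrable_disc g \<and>
     (\<forall>\<psi>\<in>test_functions.
        (LINT z:unit_disc|lebesgue. f z * dbar \<psi> z) =
        - (LINT z:unit_disc|lebesgue. g z * bc_of_complex (\<psi> z)))"

definition H_A0 :: "(complex \<Rightarrow> bicomplex) \<Rightarrow> (complex \<Rightarrow> bicomplex) set" where
  "H_A0 A = {f. has_weak_dbar f (\<lambda>z. A z * f z)}"

text \<open>
  A weak solution is determined only almost everywhere, whereas pointwise values and values on
  circles are used below; continuity selects the unique continuous representative.
\<close>

definition Hol_disc :: "(complex \<Rightarrow> bicomplex) set" where
  "Hol_disc = {f. continuous_on unit_disc f \<and> has_weak_dbar f (\<lambda>_. 0)}"

definition theodorescu :: "(complex \<Rightarrow> bicomplex) \<Rightarrow> complex \<Rightarrow> bicomplex" where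
  "theodorescu g z =
     p_plus * bc_of_complex
       (- (1 / pi) * (LINT \<zeta>:unit_disc|lebesgue. bc_plus (g \<zeta>) / (cnj \<zeta> - cnj z))) +
     p_minus * bc_of_complex
       (- (1 / pi) * (LINT \<zeta>:unit_disc|lebesgue. bc_minus (g \<zeta>) / (\<zeta> - z)))"

section \<open>Boundary values in the sense of distributions\<close>

text \<open>Smooth functions on the circle, as \<open>2 * pi\<close>-periodic functions of the angle.\<close>

definition smooth_circle :: "(real \<Rightarrow> complex) set" where
  "smooth_circle = {\<psi>. (\<forall>\<theta>. \<psi> (\<theta> + 2 * pi) = \<psi> \<theta>) \<and>
     (\<exists>d :: nat \<Rightarrow> real \<Rightarrow> complex. d 0 = \<psi> \<and>
        (\<forall>n \<theta>. (d n has_vector_derivative d (Suc n) \<theta>) (at \<theta>)))}"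

text \<open>
  The Bochner integral of a non-integrable function is \<open>0\<close> by convention, so integrability is
  required explicitly for the limit to be meaningful.
\<close>

definition has_distributional_boundary_value :: "(complex \<Rightarrow> bicomplex) \<Rightarrow> bool" where
  "has_distributional_boundary_value f \<longleftrightarrow> (\<forall>\<psi>\<in>smooth_circle.
     (\<forall>\<^sub>F r in at_left 1.
        set_integrable lebesgue {0..2 * pi} (\<lambda>\<theta>. f (rcis r \<theta>) * bc_of_complex (\<psi> \<theta>))) \<and>
     (\<exists>L. ((\<lambda>r. LINT \<theta>:{0..2 * pi}|lebesgue. f (rcis r \<theta>) * bc_of_complex (\<psi> \<theta>)) \<longlongrightarrow> L)
        (at_left 1)))"

end

theory Submission
  imports Defs "HOL-Complex_Analysis.Complex_Analysis"
begin

text \<open>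
  Multiplication by \<open>e\<^sup>T\<close>, with \<open>T\<close> the Theodorescu potential of \<open>A\<close>, is harmless: for \<open>q > 2\<close> the
  potential is bounded on the disc, because the conjugate exponent \<open>p\<close> is below 2 and the kernel
  \<open>1 / |\<zeta> - z|\<close> is bounded in \<open>L\<^sup>p\<close> of the disc uniformly in \<open>z\<close> (\<open>theodorescu_bounded\<close>). So \<open>w\<close> and
  \<open>\<phi>\<close> have the same idempotent components up to factors bounded above and away from 0, and the
  claim is about \<open>\<phi>\<close> alone. The component \<open>\<phi>\<^sup>-\<close> and the conjugate of \<open>\<phi>\<^sup>+\<close> are continuous weak
  solutions of the Cauchy-Riemann equation, hence holomorphic by Weyl's lemma
  (\<open>continuous_weak_solution_holomorphic\<close>), and both conditions pass to components. What is left is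
  the classical statement for one holomorphic function \<open>g\<close> with Taylor coefficients \<open>a\<^sub>n\<close>
  (\<open>holomorphic_boundary_value_iff_moderate_growth\<close>).

  Its two conditions are both equivalent to polynomial growth of \<open>a\<^sub>n\<close>. For the growth of \<open>g\<close> this is
  Cauchy's estimate on the circle of radius \<open>(n + 1) / (n + 2)\<close> in one direction, and summation of
  \<open>(n + 1)\<^sup>m r\<^sup>n\<close> in the other. For the boundary value, the pairing of \<open>g(r e\<^sup>i\<^sup>\<theta>)\<close> with \<open>\<psi>\<close> is
  \<open>\<Sum> a\<^sub>n c\<^sub>n r\<^sup>n\<close>, where \<open>c\<^sub>n\<close> are the Fourier coefficients of \<open>\<psi>\<close>. They decrease rapidly, so
  polynomially bounded \<open>a\<^sub>n\<close> make the series converge uniformly up to \<open>r = 1\<close>. If instead \<open>a\<^sub>n\<close>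
  outgrows every power of \<open>n\<close> along a subsequence, then \<open>1 / a\<^sub>n\<close> on a suitable subsequence is rapidly
  decreasing. A smooth \<open>\<psi>\<close> with these Fourier coefficients turns the pairing into a multiple of
  \<open>\<Sum> r\<^sup>n\<close> over an infinite set of exponents, which tends to infinity as \<open>r\<close> tends to 1
  (\<open>diverging_test_function\<close>).
\<close>

section \<open>Boundedness of the Theodorescu potential\<close>

text \<open>
  If \<open>2\<^sup>-\<^sup>k \<le> |\<zeta> - z| < 2 \<cdot> 2\<^sup>-\<^sup>k\<close> then the \<open>k\<close>-th term on the right already dominates the kernel.
\<close>

lemma ball_power_kernel_dyadic_bound:
  fixes z \<zeta> :: complex
  assumes "p \<ge> 0"
  shows "ennreal (indicator (ball z 2) \<zeta> * cmod (\<zeta> - z) powr (- p)) \<le>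
    (\<Sum>k. ennreal (2 powr (p * real k)) * indicator (ball z (2 * (1/2) ^ k)) \<zeta>)"
    (is "_ \<le> (\<Sum>k. ?f k)")
proof (cases "\<zeta> \<in> ball z 2 \<and> \<zeta> \<noteq> z")
  case True
  then have pos: "cmod (\<zeta> - z) > 0" and lt: "cmod (\<zeta> - z) < 2"
    by (auto simp: dist_norm norm_minus_commute)
  \<comment> \<open>The index of the dyadic annulus around \<open>z\<close> that contains \<open>\<zeta>\<close>.\<close>
  define k where "k = (LEAST k. (1/2) ^ k \<le> cmod (\<zeta> - z))"
  have "\<exists>k. (1/2::real) ^ k \<le> cmod (\<zeta> - z)"
    using real_arch_pow_inv[OF pos, of "1/2"] by (auto intro: less_imp_le)
  then have k1: "(1/2) ^ k \<le> cmod (\<zeta> - z)"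
    unfolding k_def by (rule LeastI_ex)
  have k2: "cmod (\<zeta> - z) < 2 * (1/2) ^ k"
  proof (cases k)
    case 0
    with lt show ?thesis by simp
  next
    case (Suc j)
    then have "\<not> (1/2) ^ j \<le> cmod (\<zeta> - z)"
      unfolding k_def by (metis lessI not_less_Least)
    then show ?thesis using Suc by simp
  qed
  have "cmod (\<zeta> - z) powr (- p) \<le> ((1/2) ^ k) powr (- p)"
    using k1 pos assms by (intro powr_mono2') auto
  also have "((1/2::real) ^ k) powr (- p) = 2 powr (p * real k)"
  proof -
    have "(1/2::real) ^ k = 2 powr (- real k)"
      by (simp add: powr_minus powr_realpow power_one_over inverse_eq_divide)
    then show ?thesis by (simp add: powr_powr mult.commute)
  qed
  finally have "ennreal (indicator (ball z 2) \<zeta> * cmod (\<zeta> - z) powr (- p)) \<le> ?f k"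
    using True k2 by (auto simp: dist_norm norm_minus_commute intro!: ennreal_leI)
  also have "\<dots> = sum ?f {k}" by (simp only: sum.insert finite.emptyI empty_iff not_False_eq_True sum.empty add_0_right)
  also have "\<dots> \<le> (\<Sum>k. ?f k)"
    by (rule sum_le_suminf) auto
  finally show ?thesis .
qed auto

text \<open>
  The dyadic sum is integrated term by term. A disc of radius \<open>2 \<cdot> 2\<^sup>-\<^sup>k\<close> has area proportional to
  \<open>4\<^sup>-\<^sup>k\<close>, so a geometric series of ratio \<open>2\<^sup>p\<^sup>-\<^sup>2 < 1\<close> results, and it does not involve \<open>z\<close>.
\<close>

lemma power_kernel_integral_uniformly_bounded:
  fixes p :: real
  assumes "0 \<le> p" "p < 2"
  obtains M where "M \<ge> 0"
    "\<And>z::complex. (\<integral>\<^sup>+\<zeta>. ennreal (indicator (ball z 2) \<zeta> * cmod (\<zeta> - z) powr (- p)) \<partial>lebesgue) \<le> ennreal M"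
proof -
  define a where "a k = 2 powr (p * real k) * (unit_ball_vol 2 * (2 * (1/2) ^ k)\<^sup>2)" for k
  have a_eq: "a k = 4 * unit_ball_vol 2 * (2 powr (p - 2)) ^ k" for k
  proof -
    have "2 powr (p * real k) * ((1/2) ^ k)\<^sup>2 = (2 powr (p - 2)) ^ k"
    proof -
      have "(1/2::real) ^ k = 2 powr (- real k)"
        by (simp add: powr_minus powr_realpow power_one_over inverse_eq_divide)
      then have "2 powr (p * real k) * ((1/2) ^ k)\<^sup>2 = 2 powr (p * real k + (- real k + - real k))"
        by (simp only: power2_eq_square powr_add)
      also have "\<dots> = 2 powr ((p - 2) * real k)" by (simp add: algebra_simps)
      also have "\<dots> = (2 powr (p - 2)) powr real k" by (simp only: powr_powr)
      also have "\<dots> = (2 powr (p - 2)) ^ k" by (simp add: powr_realpow)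
      finally show ?thesis .
    qed
    then show ?thesis by (simp add: a_def power_mult_distrib)
  qed
  have nn: "a k \<ge> 0" for k unfolding a_def by simp
  have sm: "summable a"
    unfolding a_eq using assms by (intro summable_mult summable_geometric) (simp add: powr_less_one)
  show ?thesis
  proof (rule that)
    show "suminf a \<ge> 0" by (rule suminf_nonneg[OF sm nn])
    fix z :: complex
    have "(\<integral>\<^sup>+\<zeta>. ennreal (indicator (ball z 2) \<zeta> * cmod (\<zeta> - z) powr (- p)) \<partial>lebesgue)
        \<le> (\<integral>\<^sup>+\<zeta>. (\<Sum>k. ennreal (2 powr (p * real k)) * indicator (ball z (2 * (1/2) ^ k)) \<zeta>) \<partial>lebesgue)"
      by (rule nn_integral_mono) (rule ball_power_kernel_dyadic_bound[OF assms(1)])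
    also have "\<dots> = (\<Sum>k. \<integral>\<^sup>+\<zeta>. ennreal (2 powr (p * real k)) * indicator (ball z (2 * (1/2) ^ k)) \<zeta> \<partial>lebesgue)"
      by (rule nn_integral_suminf[where f = "\<lambda>k \<zeta>. ennreal (2 powr (p * real k)) * indicator (ball z (2 * (1/2) ^ k)) \<zeta>"])
        (intro borel_measurable_times_ennreal borel_measurable_const borel_measurable_indicator, simp)
    also have "\<dots> = (\<Sum>k. ennreal (a k))"
    proof (rule suminf_cong)
      fix k :: nat
      have "(\<integral>\<^sup>+\<zeta>. ennreal (2 powr (p * real k)) * indicator (ball z (2 * (1/2) ^ k)) \<zeta> \<partial>lebesgue)
          = ennreal (2 powr (p * real k)) * emeasure lebesgue (ball z (2 * (1/2) ^ k))"
        by (rule nn_integral_cmult_indicator) simp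
      also have "\<dots> = ennreal (a k)"
        by (simp add: emeasure_ball a_def ennreal_mult')
      finally show "(\<integral>\<^sup>+\<zeta>. ennreal (2 powr (p * real k)) * indicator (ball z (2 * (1/2) ^ k)) \<zeta> \<partial>lebesgue)
          = ennreal (a k)" .
    qed
    also have "\<dots> = ennreal (suminf a)"
      by (rule suminf_ennreal2[OF nn sm])
    finally show "(\<integral>\<^sup>+\<zeta>. ennreal (indicator (ball z 2) \<zeta> * cmod (\<zeta> - z) powr (- p)) \<partial>lebesgue)
        \<le> ennreal (suminf a)" .
  qed
qed

lemma cmod_bc_le: "cmod (bc_plus u) \<le> 2 * norm u" "cmod (bc_minus u) \<le> 2 * norm u"
proof -
  have "(norm u)\<^sup>2 = ((cmod (bc_plus u))\<^sup>2 + (cmod (bc_minus u))\<^sup>2) / 2"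
    unfolding norm_bicomplex_def by simp
  then have "(cmod (bc_plus u))\<^sup>2 \<le> (2 * norm u)\<^sup>2" "(cmod (bc_minus u))\<^sup>2 \<le> (2 * norm u)\<^sup>2"
    using zero_le_power2[of "cmod (bc_plus u)"] zero_le_power2[of "cmod (bc_minus u)"]
    unfolding power_mult_distrib by (simp_all, linarith+)
  then show "cmod (bc_plus u) \<le> 2 * norm u" "cmod (bc_minus u) \<le> 2 * norm u"
    by (auto intro: power2_le_imp_le)
qed

text \<open>
  Young's inequality \<open>x y \<le> x\<^sup>q + y\<^sup>p\<close> splits the product into a part that is integrable by
  assumption and a part controlled by the kernel bound. The bound concerns the norm of the integral
  only, so that a non-integrable \<open>f\<close>, whose integral is 0 by convention, is covered too.
\<close>

lemma disc_Cauchy_transform_bounded: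
  fixes a :: "complex \<Rightarrow> real"
  assumes "q > 2" and int: "set_integrable lebesgue unit_disc (\<lambda>z. a z powr q)" and a0: "\<And>z. a z \<ge> 0"
  obtains M where "\<And>f z. z \<in> unit_disc \<Longrightarrow> (\<And>\<zeta>. cmod (f \<zeta>) \<le> a \<zeta> / cmod (\<zeta> - z)) \<Longrightarrow>
    cmod (LINT \<zeta>:unit_disc|lebesgue. f \<zeta>) \<le> M"
proof -
  define p where "p = q / (q - 1)"
  have p: "p > 1" "p < 2" "1/q + 1/p = 1"
    using assms(1) by (auto simp: p_def field_simps)
  obtain M where M: "M \<ge> 0"
    "\<And>z::complex. (\<integral>\<^sup>+\<zeta>. ennreal (indicator (ball z 2) \<zeta> * cmod (\<zeta> - z) powr (- p)) \<partial>lebesgue) \<le> ennreal M"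
    using power_kernel_integral_uniformly_bounded[of p] p by auto
  define N where "N = (LINT z:unit_disc|lebesgue. a z powr q)"
  have N0: "N \<ge> 0" unfolding N_def set_lebesgue_integral_def by (intro integral_nonneg_AE) (auto simp: indicator_def)
  have Nnn: "(\<integral>\<^sup>+\<zeta>. ennreal (indicator unit_disc \<zeta> * a \<zeta> powr q) \<partial>lebesgue) = ennreal N"
    using nn_integral_eq_integral[OF int[unfolded set_integrable_def]]
    by (simp add: N_def set_lebesgue_integral_def)
  show ?thesis
  proof (rule that)
    fix f :: "complex \<Rightarrow> complex" and z :: complex
    assume z: "z \<in> unit_disc" and f: "\<And>\<zeta>. cmod (f \<zeta>) \<le> a \<zeta> / cmod (\<zeta> - z)"
    let ?F = "\<lambda>\<zeta>. indicator unit_disc \<zeta> *\<^sub>R f \<zeta>"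
    show "cmod (LINT \<zeta>:unit_disc|lebesgue. f \<zeta>) \<le> N + M"
    proof (cases "integrable lebesgue ?F")
      case False
      then show ?thesis
        using N0 M(1) by (simp add: set_lebesgue_integral_def not_integrable_integral_eq)
    next
      case True
      have pt: "cmod (?F \<zeta>) \<le> indicator unit_disc \<zeta> * a \<zeta> powr q
          + indicator (ball z 2) \<zeta> * cmod (\<zeta> - z) powr (- p)" for \<zeta>
      proof (cases "\<zeta> \<in> unit_disc")
        case True
        have "dist z \<zeta> < 2"
          using True z dist_triangle[of z \<zeta> 0] by (simp add: dist_commute)
        then have "\<zeta> \<in> ball z 2" by simp
        have "a \<zeta> * inverse (cmod (\<zeta> - z)) \<le> a \<zeta> powr q / q + inverse (cmod (\<zeta> - z)) powr p / p"
          using assms(1) p a0 by (intro Youngs_inequality) auto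
        also have "\<dots> \<le> a \<zeta> powr q / 1 + inverse (cmod (\<zeta> - z)) powr p / 1"
          using assms(1) p by (intro add_mono divide_left_mono) auto
        also have "inverse (cmod (\<zeta> - z)) powr p = cmod (\<zeta> - z) powr (- p)"
          by (simp add: powr_minus inverse_powr)
        finally show ?thesis
          using f[of \<zeta>] True \<open>\<zeta> \<in> ball z 2\<close> by (simp add: divide_inverse)
      qed auto
      have "ennreal (cmod (integral\<^sup>L lebesgue ?F)) \<le> (\<integral>\<^sup>+\<zeta>. ennreal (cmod (?F \<zeta>)) \<partial>lebesgue)"
        by (rule integral_norm_bound_ennreal[OF True])
      also have "\<dots> \<le> (\<integral>\<^sup>+\<zeta>. (ennreal (indicator unit_disc \<zeta> * a \<zeta> powr q)
          + ennreal (indicator (ball z 2) \<zeta> * cmod (\<zeta> - z) powr (- p))) \<partial>lebesgue)"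
        by (intro nn_integral_mono, subst ennreal_plus[symmetric])
          (use pt in \<open>auto intro!: ennreal_leI simp del: norm_scaleR ennreal_plus\<close>)
      also have "\<dots> = (\<integral>\<^sup>+\<zeta>. ennreal (indicator unit_disc \<zeta> * a \<zeta> powr q) \<partial>lebesgue)
          + (\<integral>\<^sup>+\<zeta>. ennreal (indicator (ball z 2) \<zeta> * cmod (\<zeta> - z) powr (- p)) \<partial>lebesgue)"
      proof (rule nn_integral_add)
        show "(\<lambda>\<zeta>. ennreal (indicator unit_disc \<zeta> * a \<zeta> powr q)) \<in> borel_measurable lebesgue"
          using borel_measurable_integrable[OF int[unfolded set_integrable_def]] by auto
        show "(\<lambda>\<zeta>. ennreal (indicator (ball z 2) \<zeta> * cmod (\<zeta> - z) powr (- p))) \<in> borel_measurable lebesgue"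
        proof -
          have "(\<lambda>\<zeta>. ennreal (indicator (ball z 2) \<zeta> * cmod (\<zeta> - z) powr (- p))) \<in> borel_measurable borel"
            by (intro measurable_compose[OF _ measurable_ennreal] borel_measurable_times
                borel_measurable_indicator powr_real_measurable borel_measurable_const
                borel_measurable_continuous_onI continuous_intros) auto
          then show ?thesis by (intro measurable_completion) simp
        qed
      qed
      also have "\<dots> \<le> ennreal N + ennreal M"
        using Nnn M(2) by (intro add_mono) auto
      also have "\<dots> = ennreal (N + M)"
        using N0 M(1) by simp
      finally show ?thesis
        using N0 M(1) by (simp add: set_lebesgue_integral_def del: ennreal_plus)
    qed
  qed
qed

lemma bc_idempotent_components [simp]:
  "bc_plus (p_plus * bc_of_complex a + p_minus * bc_of_complex b) = a"
  "bc_minus (p_plus * bc_of_complex a + p_minus * bc_of_complex b) = b"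
  using bicomplex_decomposition[of "p_plus * bc_of_complex a + p_minus * bc_of_complex b" a b] by auto

lemma theodorescu_bounded:
  assumes "q > 2" "A \<in> Lq_disc q"
  obtains M where "\<And>z. z \<in> unit_disc \<Longrightarrow> cmod (bc_plus (theodorescu A z)) \<le> M"
    "\<And>z. z \<in> unit_disc \<Longrightarrow> cmod (bc_minus (theodorescu A z)) \<le> M"
proof -
  have "set_integrable lebesgue unit_disc (\<lambda>z. norm (A z) powr q)"
    using assms(2) by (simp add: Lq_disc_def)
  then have "set_integrable lebesgue unit_disc (\<lambda>z. 2 powr q * norm (A z) powr q)"
    by (rule set_integrable_mult_right)
  then have "set_integrable lebesgue unit_disc (\<lambda>z. (2 * norm (A z)) powr q)"
    by (simp add: powr_mult)
  then obtain M where M: "\<And>f z. z \<in> unit_disc \<Longrightarrow> (\<And>\<zeta>. cmod (f \<zeta>) \<le> (2 * norm (A \<zeta>)) / cmod (\<zeta> - z)) \<Longrightarrow>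
    cmod (LINT \<zeta>:unit_disc|lebesgue. f \<zeta>) \<le> M"
    by (rule disc_Cauchy_transform_bounded[OF assms(1)]) auto
  show ?thesis
  proof (rule that)
    fix z assume z: "z \<in> unit_disc"
    have "cmod (LINT \<zeta>:unit_disc|lebesgue. bc_plus (A \<zeta>) / (cnj \<zeta> - cnj z)) \<le> M"
      by (rule M[OF z]) (auto simp: norm_divide cmod_bc_le divide_right_mono simp flip: complex_cnj_diff)
    then show "cmod (bc_plus (theodorescu A z)) \<le> 1 / pi * M"
      by (simp add: theodorescu_def norm_mult norm_divide divide_right_mono)
    have "cmod (LINT \<zeta>:unit_disc|lebesgue. bc_minus (A \<zeta>) / (\<zeta> - z)) \<le> M"
      by (rule M[OF z]) (auto simp: norm_divide cmod_bc_le divide_right_mono)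
    then show "cmod (bc_minus (theodorescu A z)) \<le> 1 / pi * M"
      by (simp add: theodorescu_def norm_mult norm_divide divide_right_mono)
  qed
qed

section \<open>Smooth bump functions\<close>

text \<open>
  Existence of \<open>k\<close> successive derivatives, by recursion: closure under products is then an induction
  on \<open>k\<close> with the ordinary product rule instead of the Leibniz formula of order \<open>k\<close>.
\<close>

primrec times_differentiable :: "nat \<Rightarrow> (real \<Rightarrow> real) \<Rightarrow> bool" where
  "times_differentiable 0 f \<longleftrightarrow> True"
| "times_differentiable (Suc k) f \<longleftrightarrow>
    (\<exists>f'. (\<forall>x. (f has_real_derivative f' x) (at x)) \<and> times_differentiable k f')"

lemma times_differentiable_SucI:
  assumes "\<And>x. (f has_real_derivative f' x) (at x)" "times_differentiable k f'"
  shows "times_differentiable (Suc k) f"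
  using assms by auto

lemma times_differentiable_Suc_imp: "times_differentiable (Suc k) f \<Longrightarrow> times_differentiable k f"
  by (induction k arbitrary: f) auto

lemma times_differentiable_add:
  "times_differentiable k f \<Longrightarrow> times_differentiable k g \<Longrightarrow> times_differentiable k (\<lambda>x. f x + g x)"
proof (induction k arbitrary: f g)
  case (Suc k)
  then obtain f' g' where "\<forall>x. (f has_real_derivative f' x) (at x)" "times_differentiable k f'"
    "\<forall>x. (g has_real_derivative g' x) (at x)" "times_differentiable k g'" by auto
  then show ?case using Suc.IH[of f' g']
    by (auto intro!: exI[of _ "\<lambda>x. f' x + g' x"] derivative_eq_intros)
qed simp

lemma times_differentiable_cmult:
  "times_differentiable k f \<Longrightarrow> times_differentiable k (\<lambda>x. c * f x)"
proof (induction k arbitrary: f)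
  case (Suc k)
  then obtain f' where "\<forall>x. (f has_real_derivative f' x) (at x)" "times_differentiable k f'" by auto
  then show ?case using Suc.IH[of f']
    by (auto intro!: exI[of _ "\<lambda>x. c * f' x"] DERIV_cmult)
qed simp

lemma times_differentiable_mult:
  "times_differentiable k f \<Longrightarrow> times_differentiable k g \<Longrightarrow> times_differentiable k (\<lambda>x. f x * g x)"
proof (induction k arbitrary: f g)
  case (Suc k)
  then obtain f' g' where d: "\<forall>x. (f has_real_derivative f' x) (at x)" "times_differentiable k f'"
    "\<forall>x. (g has_real_derivative g' x) (at x)" "times_differentiable k g'" by auto
  have "times_differentiable k (\<lambda>x. f' x * g x + f x * g' x)"
    using Suc d by (intro times_differentiable_add Suc.IH) (auto dest: times_differentiable_Suc_imp simp del: times_differentiable.simps(2))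
  moreover have "((\<lambda>x. f x * g x) has_real_derivative f' x * g x + f x * g' x) (at x)" for x
    using d by (auto intro!: derivative_eq_intros)
  ultimately show ?case by (intro times_differentiable_SucI)
qed simp

lemma times_differentiable_affine:
  "times_differentiable k f \<Longrightarrow> times_differentiable k (\<lambda>x. f (a + c * x))"
proof (induction k arbitrary: f)
  case (Suc k)
  then obtain f' where d: "\<forall>x. (f has_real_derivative f' x) (at x)" "times_differentiable k f'" by auto
  have "times_differentiable k (\<lambda>x. c * f' (a + c * x))"
    by (rule times_differentiable_cmult[OF Suc.IH[OF d(2)]])
  moreover have "((\<lambda>x. f (a + c * x)) has_real_derivative c * f' (a + c * x)) (at x)" for x
    by (rule DERIV_chain2[OF d(1)[rule_format], of "\<lambda>x. a + c * x" c, THEN DERIV_cong])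
      (auto intro!: derivative_eq_intros)
  ultimately show ?case by (intro times_differentiable_SucI)
qed simp

definition flat_exp :: "nat \<Rightarrow> real \<Rightarrow> real" where
  "flat_exp n t = (if t > 0 then exp (- (1 / t)) / t ^ n else 0)"

lemma flat_exp_tendsto_0: "(flat_exp n \<longlongrightarrow> 0) (at 0)"
proof -
  have "((\<lambda>x. flat_exp n (inverse x)) \<longlongrightarrow> 0) at_top"
  proof (rule Lim_transform_eventually[OF tendsto_power_div_exp_0[of n]])
    show "\<forall>\<^sub>F x in at_top. x ^ n / exp x = flat_exp n (inverse x)"
      using eventually_gt_at_top[of 0]
      by eventually_elim (simp add: flat_exp_def exp_minus divide_inverse power_inverse mult.commute)
  qed
  then have r: "(flat_exp n \<longlongrightarrow> 0) (at_right 0)"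
    by (simp add: filterlim_at_right_to_top)
  have l: "(flat_exp n \<longlongrightarrow> 0) (at_left 0)"
    by (rule Lim_transform_eventually[OF tendsto_const])
      (auto simp: flat_exp_def eventually_at_filter)
  from l r show ?thesis by (simp add: filterlim_split_at)
qed

text \<open>
  The functions \<open>t\<^sup>-\<^sup>n e\<^sup>-\<^sup>1\<^sup>/\<^sup>t\<close>, extended by 0, are closed under differentiation up to linear
  combinations. This reduces the smoothness of \<open>e\<^sup>-\<^sup>1\<^sup>/\<^sup>t\<close> to a single derivative rule.
\<close>

lemma flat_exp_has_derivative:
  "(flat_exp n has_real_derivative - real n * flat_exp (Suc n) t + flat_exp (Suc (Suc n)) t) (at t)"
proof -
  consider "t > 0" | "t < 0" | "t = 0" by linarith
  then show ?thesis
  proof cases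
    case 1
    have "((\<lambda>t. exp (- (1 / t)) / t ^ n) has_real_derivative
        - real n * flat_exp (Suc n) t + flat_exp (Suc (Suc n)) t) (at t)"
    proof (rule DERIV_cong)
      show "((\<lambda>t. exp (- (1 / t)) / t ^ n) has_real_derivative
        (exp (- (1 / t)) * (1 / (t * t)) * t ^ n - exp (- (1 / t)) * (real n * t ^ (n - 1))) / (t ^ n * t ^ n)) (at t)"
        using 1 by (auto intro!: derivative_eq_intros)
      show "(exp (- (1 / t)) * (1 / (t * t)) * t ^ n - exp (- (1 / t)) * (real n * t ^ (n - 1))) / (t ^ n * t ^ n)
        = - real n * flat_exp (Suc n) t + flat_exp (Suc (Suc n)) t"
        using 1 by (cases n) (simp_all add: flat_exp_def field_simps)
    qed
    then show ?thesis
      by (rule has_field_derivative_transform_within_open[where S = "{0<..}"])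
        (use 1 in \<open>auto simp: flat_exp_def\<close>)
  next
    case 2
    have "((\<lambda>_. 0) has_real_derivative 0) (at t)" by simp
    then have "(flat_exp n has_real_derivative 0) (at t)"
      by (rule has_field_derivative_transform_within_open[where S = "{..<0}"])
        (use 2 in \<open>auto simp: flat_exp_def\<close>)
    then show ?thesis using 2 by (simp add: flat_exp_def)
  next
    case 3
    have "((\<lambda>h. (flat_exp n (0 + h) - flat_exp n 0) / h) \<longlongrightarrow> 0) (at 0)"
    proof (rule Lim_transform_eventually[OF flat_exp_tendsto_0[of "Suc n"]])
      show "\<forall>\<^sub>F h in at 0. flat_exp (Suc n) h = (flat_exp n (0 + h) - flat_exp n 0) / h"
        by (auto simp: flat_exp_def eventually_at_filter)
    qed
    then show ?thesis using 3 by (simp add: DERIV_def flat_exp_def)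
  qed
qed

lemma flat_exp_smooth: "times_differentiable k (flat_exp n)"
proof (induction k arbitrary: n)
  case (Suc k)
  have "times_differentiable k (\<lambda>t. - real n * flat_exp (Suc n) t + flat_exp (Suc (Suc n)) t)"
    by (intro times_differentiable_add times_differentiable_cmult Suc.IH)
  with flat_exp_has_derivative[of n] show ?case by (rule times_differentiable_SucI)
qed simp

lemma smooth_derivative_sequence:
  assumes "\<And>k. times_differentiable k f"
  obtains d :: "nat \<Rightarrow> real \<Rightarrow> real" where "d 0 = f"
    "\<And>n x. (d n has_real_derivative d (Suc n) x) (at x)"
proof -
  have step: "(g has_real_derivative deriv g x) (at x)" "times_differentiable k (deriv g)"
    if "\<And>k. times_differentiable k g" for g k x
  proof -
    have "times_differentiable (Suc k) g" by (rule that)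
    then obtain g' where g': "\<forall>x. (g has_real_derivative g' x) (at x)" "times_differentiable k g'"
      by auto
    then have "deriv g = g'" by (auto intro!: DERIV_imp_deriv)
    with g' show "(g has_real_derivative deriv g x) (at x)" "times_differentiable k (deriv g)" by auto
  qed
  have "times_differentiable k ((deriv ^^ n) f)" for n k
    by (induction n arbitrary: k) (auto intro: assms step)
  then show ?thesis
    by (intro that[of "\<lambda>n. (deriv ^^ n) f"]) (auto intro: step)
qed

text \<open>
  The bump is \<open>f(x) = h(\<epsilon> + x) h(\<epsilon> - x)\<close> with \<open>h(t) = e\<^sup>-\<^sup>1\<^sup>/\<^sup>t\<close> for \<open>t > 0\<close>. It is delivered together
  with all its derivatives because smooth functions of the plane are described by such families.
\<close>

lemma smooth_bump:
  fixes \<epsilon> :: real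
  assumes "\<epsilon> > 0"
  obtains d :: "nat \<Rightarrow> real \<Rightarrow> real" where
    "\<And>n x. (d n has_real_derivative d (Suc n) x) (at x)"
    "\<And>x. d 0 x \<ge> 0" "d 0 0 > 0" "\<And>n x. \<bar>x\<bar> > \<epsilon> \<Longrightarrow> d n x = 0"
proof -
  define f where "f x = flat_exp 0 (\<epsilon> + 1 * x) * flat_exp 0 (\<epsilon> + (- 1) * x)" for x
  have "times_differentiable k f" for k
    unfolding f_def by (intro times_differentiable_mult times_differentiable_affine flat_exp_smooth)
  then obtain d where d: "d 0 = f" "\<And>n x. (d n has_real_derivative d (Suc n) x) (at x)"
    using smooth_derivative_sequence by blast
  have "d n x = 0" if "\<bar>x\<bar> > \<epsilon>" for n x
    using that
  proof (induction n arbitrary: x)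
    case 0
    then show ?case by (auto simp: d(1) f_def flat_exp_def)
  next
    case (Suc n)
    have "open {x. \<bar>x\<bar> > \<epsilon>}" by (intro open_Collect_less continuous_intros)
    then have "((\<lambda>_. 0) has_real_derivative d (Suc n) x) (at x)"
      using has_field_derivative_transform_within_open[OF d(2), where S = "{x. \<bar>x\<bar> > \<epsilon>}" and g = "\<lambda>_. 0"] Suc
      by auto
    then show ?case using DERIV_unique[OF DERIV_const] by metis
  qed
  moreover have "d 0 x \<ge> 0" for x by (simp add: d(1) f_def flat_exp_def)
  moreover have "d 0 0 > 0" using assms by (simp add: d(1) f_def flat_exp_def)
  ultimately show ?thesis using that d(2) by blast
qed

section \<open>Weyl's lemma for the Cauchy-Riemann operator\<close>

text \<open>
  The kernel is the product of a bump in \<open>Re (\<zeta> - z)\<close> and one in \<open>Im (\<zeta> - z)\<close>, so that its partial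
  derivatives are explicit. Differentiating under the integral sign moves \<open>\<partial>\<^sub>x + \<i> \<partial>\<^sub>y\<close>, up to sign,
  onto the kernel, and the hypothesis says that the result vanishes. These are the Cauchy-Riemann
  equations for the mollification.
\<close>

lemma mollification_holomorphic:
  fixes f :: "complex \<Rightarrow> complex" and d :: "nat \<Rightarrow> real \<Rightarrow> real"
  assumes f: "continuous_on (cbox a b) f"
    and d: "\<And>n x. (d n has_real_derivative d (Suc n) x) (at x)"
    and U: "open U" "convex U"
    and weak: "\<And>z. z \<in> U \<Longrightarrow> integral (cbox a b) (\<lambda>\<zeta>. f \<zeta> *
      (of_real (d 1 (Re (\<zeta> - z)) * d 0 (Im (\<zeta> - z))) + \<i> * of_real (d 0 (Re (\<zeta> - z)) * d 1 (Im (\<zeta> - z))))) = 0"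
  shows "(\<lambda>z. integral (cbox a b) (\<lambda>\<zeta>. f \<zeta> * of_real (d 0 (Re (\<zeta> - z)) * d 0 (Im (\<zeta> - z))))) holomorphic_on U"
proof -
  let ?F = "\<lambda>z \<zeta>. f \<zeta> * of_real (d 0 (Re (\<zeta> - z)) * d 0 (Im (\<zeta> - z)))"
  let ?G = "\<lambda>z \<zeta>. f \<zeta> * of_real (d 1 (Re (\<zeta> - z)) * d 0 (Im (\<zeta> - z)))"
  let ?H = "\<lambda>z \<zeta>. f \<zeta> * of_real (d 0 (Re (\<zeta> - z)) * d 1 (Im (\<zeta> - z)))"
  define fx where "fx z \<zeta> = (blinfun_scaleR_left (- ?G z \<zeta>) o\<^sub>L Blinfun Re) + (blinfun_scaleR_left (- ?H z \<zeta>) o\<^sub>L Blinfun Im)" for z \<zeta>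
  have fx_apply: "blinfun_apply (fx z \<zeta>) h = - (Re h *\<^sub>R ?G z \<zeta> + Im h *\<^sub>R ?H z \<zeta>)" for z \<zeta> h
    by (simp add: fx_def blinfun.add_left bounded_linear_Blinfun_apply bounded_linear_Re bounded_linear_Im)
  have d1: "(d 0 has_real_derivative d 1 x) (at x)" for x
    using d[of 0 x] by simp
  have dcont: "isCont (d n) x" for n x
    using d[of n x] by (rule DERIV_isCont)
  have dcont_on: "continuous_on S (\<lambda>x. d n (g x))" if "continuous_on S g" for n S and g :: "'a::topological_space \<Rightarrow> real"
    by (rule continuous_on_compose2[of UNIV "d n", OF _ that]) (auto intro: continuous_at_imp_continuous_on dcont)
  have fc: "continuous_on (U \<times> cbox a b) (\<lambda>p. f (snd p))"
    by (rule continuous_on_compose2[OF f]) (auto intro!: continuous_intros)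
  have cont_fx: "continuous_on (U \<times> cbox a b) (\<lambda>(z, \<zeta>). fx z \<zeta>)"
    unfolding fx_def split_beta by (intro continuous_intros fc dcont_on)
  have cont: "continuous_on (cbox a b) (?F z)" "continuous_on (cbox a b) (?G z)" "continuous_on (cbox a b) (?H z)" for z
    by (intro continuous_intros f dcont_on)+
  have der: "((\<lambda>z. ?F z \<zeta>) has_derivative blinfun_apply (fx z \<zeta>)) (at z within U)" for z \<zeta>
  proof -
    have 1: "((\<lambda>z. d 0 (Re (\<zeta> - z))) has_derivative (\<lambda>h. - Re h * d 1 (Re (\<zeta> - z)))) (at z within U)"
      by (rule DERIV_compose_FDERIV[OF d1]) (auto intro!: derivative_eq_intros)
    have 2: "((\<lambda>z. d 0 (Im (\<zeta> - z))) has_derivative (\<lambda>h. - Im h * d 1 (Im (\<zeta> - z)))) (at z within U)"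
      by (rule DERIV_compose_FDERIV[OF d1]) (auto intro!: derivative_eq_intros)
    have eq: "blinfun_apply (fx z \<zeta>) = (\<lambda>h. f \<zeta> * of_real (d 0 (Re (\<zeta> - z)) * (- Im h * d 1 (Im (\<zeta> - z))) + - Re h * d 1 (Re (\<zeta> - z)) * d 0 (Im (\<zeta> - z))))"
      unfolding fx_apply by (auto simp: fun_eq_iff scaleR_conv_of_real algebra_simps)
    show ?thesis unfolding eq
      by (intro has_derivative_mult_right has_derivative_of_real has_derivative_mult[OF 1 2])
  qed
  \<comment> \<open>The hypothesis reads \<open>IG + \<i> IH = 0\<close>, which makes the real differential complex linear.\<close>
  have "(\<lambda>z. integral (cbox a b) (?F z)) field_differentiable (at z)" if z: "z \<in> U" for z
  proof -
    have int: "fx z integrable_on cbox a b"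
    proof (rule integrable_continuous)
      show "continuous_on (cbox a b) (fx z)"
      proof -
        have "continuous_on (cbox a b) (\<lambda>\<zeta>. case (z, \<zeta>) of (z, \<zeta>) \<Rightarrow> fx z \<zeta>)"
          by (rule continuous_on_compose2[OF cont_fx]) (use z in \<open>auto intro!: continuous_intros\<close>)
        then show ?thesis by simp
      qed
    qed
    have "((\<lambda>z. integral (cbox a b) (?F z)) has_derivative blinfun_apply (integral (cbox a b) (fx z))) (at z within U)"
      by (rule leibniz_rule[OF der _ cont_fx z U(2)]) (rule integrable_continuous[OF cont(1)])
    then have 1: "((\<lambda>z. integral (cbox a b) (?F z)) has_derivative blinfun_apply (integral (cbox a b) (fx z))) (at z)"
      using at_within_open[OF z U(1)] by simp
    define IG where "IG = integral (cbox a b) (?G z)"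
    define IH where "IH = integral (cbox a b) (?H z)"
    have "0 = integral (cbox a b) (\<lambda>\<zeta>. ?G z \<zeta> + \<i> * ?H z \<zeta>)"
      using weak[OF z] by (simp add: algebra_simps)
    also have "\<dots> = IG + \<i> * IH"
      unfolding IG_def IH_def using cont[of z]
      by (subst integral_add) (auto intro!: integrable_continuous continuous_intros simp: cont)
    finally have GH: "IG = - \<i> * IH" by (simp add: eq_neg_iff_add_eq_0)
    have "blinfun_apply (integral (cbox a b) (fx z)) h = \<i> * IH * h" for h
    proof -
      have "blinfun_apply (integral (cbox a b) (fx z)) h = integral (cbox a b) (\<lambda>\<zeta>. - (Re h *\<^sub>R ?G z \<zeta> + Im h *\<^sub>R ?H z \<zeta>))"
        by (simp add: blinfun_apply_integral[OF int] fx_apply)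
      also have "\<dots> = - (Re h *\<^sub>R IG + Im h *\<^sub>R IH)"
        unfolding IG_def IH_def using cont[of z]
        by (subst integral_neg, subst integral_add) (auto intro!: integrable_continuous continuous_intros simp: cont)
      also have "\<dots> = \<i> * IH * h"
        unfolding GH by (subst (3) complex_eq[of h]) (simp add: scaleR_conv_of_real algebra_simps)
      finally show ?thesis .
    qed
    then have "blinfun_apply (integral (cbox a b) (fx z)) = (*) (\<i> * IH)" by auto
    with 1 show ?thesis
      by (auto simp: field_differentiable_def has_field_derivative_def)
  qed
  then show ?thesis
    using U(1) by (simp add: holomorphic_on_open field_differentiable_def)
qed

lemma product_bump_test_function:
  fixes d :: "nat \<Rightarrow> real \<Rightarrow> real" and z :: complex
  assumes d: "\<And>n x. (d n has_real_derivative d (Suc n) x) (at x)"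
    and supp: "\<And>\<zeta>. d 0 (Re (\<zeta> - z)) * d 0 (Im (\<zeta> - z)) \<noteq> 0 \<Longrightarrow> \<zeta> \<in> cbox a b"
    and sub: "cbox a b \<subseteq> unit_disc"
  defines "\<psi> \<equiv> \<lambda>\<zeta>. complex_of_real (d 0 (Re (\<zeta> - z)) * d 0 (Im (\<zeta> - z)))"
  shows "\<psi> \<in> test_functions"
    "frechet_derivative \<psi> (at \<zeta>) = (\<lambda>h. of_real (Re h * (d 1 (Re (\<zeta> - z)) * d 0 (Im (\<zeta> - z))) + Im h * (d 0 (Re (\<zeta> - z)) * d 1 (Im (\<zeta> - z)))))"
proof -
  define D where "D m n \<zeta> = complex_of_real (d m (Re (\<zeta> - z)) * d n (Im (\<zeta> - z)))" for m n \<zeta>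
  have D: "(D m n has_derivative (\<lambda>h. Re h *\<^sub>R D (Suc m) n \<zeta> + Im h *\<^sub>R D m (Suc n) \<zeta>)) (at \<zeta>)" for m n \<zeta>
  proof -
    have 1: "((\<lambda>\<zeta>. d m (Re (\<zeta> - z))) has_derivative (\<lambda>h. Re h * d (Suc m) (Re (\<zeta> - z)))) (at \<zeta>)"
      by (rule DERIV_compose_FDERIV[OF d]) (auto intro!: derivative_eq_intros)
    have 2: "((\<lambda>\<zeta>. d n (Im (\<zeta> - z))) has_derivative (\<lambda>h. Im h * d (Suc n) (Im (\<zeta> - z)))) (at \<zeta>)"
      by (rule DERIV_compose_FDERIV[OF d]) (auto intro!: derivative_eq_intros)
    have eq: "(\<lambda>h. Re h *\<^sub>R D (Suc m) n \<zeta> + Im h *\<^sub>R D m (Suc n) \<zeta>) =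
      (\<lambda>h. of_real (d m (Re (\<zeta> - z)) * (Im h * d (Suc n) (Im (\<zeta> - z))) + Re h * d (Suc m) (Re (\<zeta> - z)) * d n (Im (\<zeta> - z))))"
      by (auto simp: fun_eq_iff D_def scaleR_conv_of_real algebra_simps)
    show ?thesis unfolding eq unfolding D_def
      by (intro has_derivative_of_real has_derivative_mult[OF 1 2])
  qed
  have \<psi>_D: "\<psi> = D 0 0" by (auto simp: \<psi>_def D_def)
  have cl: "closure {\<zeta>. \<psi> \<zeta> \<noteq> 0} \<subseteq> cbox a b"
    by (rule closure_minimal) (use supp in \<open>auto simp: \<psi>_def\<close>)
  then have "compact (closure {\<zeta>. \<psi> \<zeta> \<noteq> 0})"
    by (metis bounded_cbox bounded_subset closed_closure compact_eq_bounded_closed)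
  moreover have "smooth_plane \<psi>"
    unfolding smooth_plane_def using D \<psi>_D by (intro exI[of _ D]) auto
  ultimately show "\<psi> \<in> test_functions"
    using cl sub by (auto simp: test_functions_def)
  show "frechet_derivative \<psi> (at \<zeta>) = (\<lambda>h. of_real (Re h * (d 1 (Re (\<zeta> - z)) * d 0 (Im (\<zeta> - z))) + Im h * (d 0 (Re (\<zeta> - z)) * d 1 (Im (\<zeta> - z)))))"
    unfolding \<psi>_D using frechet_derivative_at[OF D[of 0 0 \<zeta>]]
    by (auto simp: fun_eq_iff D_def scaleR_conv_of_real)
qed

text \<open>
  Translation invariance: the mass of the kernel is the same positive number \<open>c\<close> for every centre
  \<open>z\<close> and every box containing the support. Dividing by \<open>c\<close> replaces a rescaling of the bump.
\<close>

lemma product_bump_integral: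
  fixes d :: "nat \<Rightarrow> real \<Rightarrow> real" and \<epsilon> :: real
  assumes "\<epsilon> > 0"
    and d: "\<And>n x. (d n has_real_derivative d (Suc n) x) (at x)"
    and d0: "\<And>x. d 0 x \<ge> 0" "d 0 0 > 0" "\<And>n x. \<bar>x\<bar> > \<epsilon> \<Longrightarrow> d n x = 0"
  obtains c :: real where "c > 0"
    "\<And>z a b. (\<And>\<zeta>. \<bar>Re (\<zeta> - z)\<bar> \<le> \<epsilon> \<Longrightarrow> \<bar>Im (\<zeta> - z)\<bar> \<le> \<epsilon> \<Longrightarrow> \<zeta> \<in> cbox a b) \<Longrightarrow>
      ((\<lambda>\<zeta>. d 0 (Re (\<zeta> - z)) * d 0 (Im (\<zeta> - z))) has_integral c) (cbox a b)"
proof -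
  let ?r = "\<lambda>u::complex. d 0 (Re u) * d 0 (Im u)"
  let ?B = "cbox (Complex (- \<epsilon>) (- \<epsilon>)) (Complex \<epsilon> \<epsilon>)"
  have B: "u \<in> ?B \<longleftrightarrow> \<bar>Re u\<bar> \<le> \<epsilon> \<and> \<bar>Im u\<bar> \<le> \<epsilon>" for u
    by (auto simp: in_cbox_complex_iff abs_le_iff)
  have dcont_on: "continuous_on S (\<lambda>x. d n (g x))" if "continuous_on S g" for n S and g :: "'a::topological_space \<Rightarrow> real"
    by (rule continuous_on_compose2[of UNIV "d n", OF _ that])
      (auto intro!: continuous_at_imp_continuous_on DERIV_isCont d)
  have cont: "continuous_on ?B ?r" by (intro continuous_intros dcont_on)
  define c where "c = integral ?B ?r"
  have c: "(?r has_integral c) ?B"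
    unfolding c_def by (intro integrable_integral integrable_continuous cont)
  have "c \<ge> 0" by (rule has_integral_nonneg[OF c]) (simp add: d0)
  moreover have "c \<noteq> 0"
  proof
    assume "c = 0"
    then have "?r 0 = 0"
      using c assms(1) d0(1)
      by (intro has_integral_0_cbox_imp_0[OF cont])
        (auto simp: B box_ne_empty Basis_complex_def inner_complex_def)
    then show False using d0(2) by simp
  qed
  ultimately have "c > 0" by simp
  moreover have "((\<lambda>\<zeta>. d 0 (Re (\<zeta> - z)) * d 0 (Im (\<zeta> - z))) has_integral c) (cbox a b)"
    if sub: "\<And>\<zeta>. \<bar>Re (\<zeta> - z)\<bar> \<le> \<epsilon> \<Longrightarrow> \<bar>Im (\<zeta> - z)\<bar> \<le> \<epsilon> \<Longrightarrow> \<zeta> \<in> cbox a b" for z a b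
  proof -
    have "((\<lambda>\<zeta>. ?r (\<zeta> - z)) has_integral c) ((\<lambda>u. u + z) ` ?B)"
      using has_integral_affinity[OF c, of 1 "- z"] by simp
    then show ?thesis
    proof (rule has_integral_on_superset)
      fix \<zeta> assume "\<zeta> \<notin> (\<lambda>u. u + z) ` ?B"
      then have "\<zeta> - z \<notin> ?B" by (metis diff_add_cancel imageI)
      then show "?r (\<zeta> - z) = 0"
        unfolding B using d0(3)[of _ 0] by (auto simp: not_le)
    next
      show "(\<lambda>u. u + z) ` ?B \<subseteq> cbox a b"
        using sub by (auto simp: B)
    qed
  qed
  ultimately show ?thesis by (rule that)
qed

text \<open>
  The weak equation \<open>\<partial>f / \<partial>z\<^sup>* = 0\<close>, tested against real functions only. This suffices for the
  mollifiers below and makes the condition compatible with complex conjugation.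
\<close>

definition annihilates_real_test_functions :: "(complex \<Rightarrow> complex) \<Rightarrow> bool" where
  "annihilates_real_test_functions f \<longleftrightarrow> (\<forall>\<psi>\<in>test_functions. (\<forall>\<zeta>. \<psi> \<zeta> \<in> \<real>) \<longrightarrow>
     (LINT \<zeta>:unit_disc|lebesgue. f \<zeta> *
       (frechet_derivative \<psi> (at \<zeta>) 1 + \<i> * frechet_derivative \<psi> (at \<zeta>) \<i>)) = 0)"

text \<open>
  One mollification step at scale \<open>\<epsilon>\<close>: \<open>g\<close> is an average of \<open>f\<close> over points within \<open>2 \<epsilon>\<close>, so it is as
  close to \<open>f\<close> as the oscillation of \<open>f\<close> at that scale allows. The box \<open>cbox a b\<close> leaves room for the
  kernels centred in \<open>U\<close>.
\<close>

lemma holomorphic_approximation_of_weak_solution: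
  fixes f :: "complex \<Rightarrow> complex"
  assumes f: "continuous_on unit_disc f" and weak: "annihilates_real_test_functions f"
    and sub: "cbox a b \<subseteq> unit_disc" and "\<epsilon> > 0" and U: "open U" "convex U"
    and UQ: "\<And>z \<zeta>. z \<in> U \<Longrightarrow> \<bar>Re (\<zeta> - z)\<bar> \<le> \<epsilon> \<Longrightarrow> \<bar>Im (\<zeta> - z)\<bar> \<le> \<epsilon> \<Longrightarrow> \<zeta> \<in> cbox a b"
  obtains g where "g holomorphic_on U"
    "\<And>z e. z \<in> U \<Longrightarrow> (\<And>\<zeta>. \<zeta> \<in> cbox a b \<Longrightarrow> dist \<zeta> z \<le> 2 * \<epsilon> \<Longrightarrow> dist (f \<zeta>) (f z) \<le> e) \<Longrightarrow> dist (g z) (f z) \<le> e"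
proof -
  obtain d :: "nat \<Rightarrow> real \<Rightarrow> real" where d: "\<And>n x. (d n has_real_derivative d (Suc n) x) (at x)"
    and d0: "\<And>x. d 0 x \<ge> 0" "d 0 0 > 0" "\<And>n x. \<bar>x\<bar> > \<epsilon> \<Longrightarrow> d n x = 0"
    using smooth_bump[OF \<open>\<epsilon> > 0\<close>] by metis
  obtain c where c: "c > 0" "\<And>z a b. (\<And>\<zeta>. \<bar>Re (\<zeta> - z)\<bar> \<le> \<epsilon> \<Longrightarrow> \<bar>Im (\<zeta> - z)\<bar> \<le> \<epsilon> \<Longrightarrow> \<zeta> \<in> cbox a b) \<Longrightarrow>
      ((\<lambda>\<zeta>. d 0 (Re (\<zeta> - z)) * d 0 (Im (\<zeta> - z))) has_integral c) (cbox a b)"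
    using product_bump_integral[OF \<open>\<epsilon> > 0\<close> d d0] by metis
  let ?Q = "cbox a b"
  let ?r = "\<lambda>z \<zeta>::complex. d 0 (Re (\<zeta> - z)) * d 0 (Im (\<zeta> - z))"
  let ?F = "\<lambda>z. integral ?Q (\<lambda>\<zeta>. f \<zeta> * of_real (?r z \<zeta>))"
  have fQ: "continuous_on ?Q f" by (rule continuous_on_subset[OF f sub])
  have dcont_on: "continuous_on S (\<lambda>x. d n (g x))" if "continuous_on S g" for n S and g :: "'a::topological_space \<Rightarrow> real"
    by (rule continuous_on_compose2[of UNIV "d n", OF _ that])
      (auto intro!: continuous_at_imp_continuous_on DERIV_isCont d)
  have zero: "d m (Re (\<zeta> - z)) * d n (Im (\<zeta> - z)) = 0" if "z \<in> U" "\<zeta> \<notin> ?Q" for m n z \<zeta>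
    using UQ[OF that(1), of \<zeta>] that(2) d0(3) by (metis mult_eq_0_iff not_le)
  have "?F holomorphic_on U"
  proof (rule mollification_holomorphic[where d = d, OF fQ d U])
    fix z assume z: "z \<in> U"
    let ?\<psi> = "\<lambda>\<zeta>. complex_of_real (?r z \<zeta>)"
    let ?K = "\<lambda>\<zeta>. f \<zeta> * (of_real (d 1 (Re (\<zeta> - z)) * d 0 (Im (\<zeta> - z))) + \<i> * of_real (d 0 (Re (\<zeta> - z)) * d 1 (Im (\<zeta> - z))))"
    have \<psi>: "?\<psi> \<in> test_functions" "\<And>\<zeta>. frechet_derivative ?\<psi> (at \<zeta>) = (\<lambda>h. of_real (Re h * (d 1 (Re (\<zeta> - z)) * d 0 (Im (\<zeta> - z))) + Im h * (d 0 (Re (\<zeta> - z)) * d 1 (Im (\<zeta> - z)))))"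
      by (rule product_bump_test_function[where d = d, OF d _ sub]; use zero[OF z] in blast)+
    have "(LINT \<zeta>:unit_disc|lebesgue. ?K \<zeta>) = 0"
      using weak \<psi> by (auto simp: annihilates_real_test_functions_def)
    moreover have "(LINT \<zeta>:unit_disc|lebesgue. ?K \<zeta>) = (LINT \<zeta>:?Q|lebesgue. ?K \<zeta>)"
      unfolding set_lebesgue_integral_def
    proof (rule Bochner_Integration.integral_cong[OF refl])
      fix \<zeta> show "indicator unit_disc \<zeta> *\<^sub>R ?K \<zeta> = indicator ?Q \<zeta> *\<^sub>R ?K \<zeta>"
      proof (cases "\<zeta> \<in> ?Q")
        case False
        then have "?K \<zeta> = 0"
          by (simp only: zero[OF z False] of_real_0 mult_zero_right add_0_right)
        then show ?thesis by (simp only: scaleR_zero_right)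
      qed (use sub in auto)
    qed
    moreover have "(LINT \<zeta>:?Q|lebesgue. ?K \<zeta>) = integral ?Q ?K"
      by (intro set_lebesgue_integral_eq_integral absolutely_integrable_continuous continuous_intros fQ dcont_on)
    ultimately show "integral ?Q ?K = 0" by simp
  qed
  then have "(\<lambda>z. ?F z / of_real c) holomorphic_on U"
    using c(1) by (intro holomorphic_intros) auto
  moreover have "dist (?F z / of_real c) (f z) \<le> e"
    if z: "z \<in> U" and e: "\<And>\<zeta>. \<zeta> \<in> ?Q \<Longrightarrow> dist \<zeta> z \<le> 2 * \<epsilon> \<Longrightarrow> dist (f \<zeta>) (f z) \<le> e" for z e
  proof -
    have rc: "(?r z has_integral c) ?Q"
      by (rule c(2)) (use UQ[OF z] in auto)
    have i1: "((\<lambda>\<zeta>. f z * of_real (?r z \<zeta>)) has_integral f z * of_real c) ?Q"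
      using has_integral_mult_right[OF has_integral_of_real[OF rc]] by blast
    have i2: "((\<lambda>\<zeta>. f \<zeta> * of_real (?r z \<zeta>)) has_integral ?F z) ?Q"
      by (intro integrable_integral integrable_continuous continuous_intros fQ dcont_on)
    have i3: "((\<lambda>\<zeta>. (f \<zeta> - f z) * of_real (?r z \<zeta>)) has_integral ?F z - f z * of_real c) ?Q"
      using has_integral_diff[OF i2 i1] by (simp add: algebra_simps)
    have "norm (integral ?Q (\<lambda>\<zeta>. (f \<zeta> - f z) * of_real (?r z \<zeta>))) \<le> integral ?Q (\<lambda>\<zeta>. e * ?r z \<zeta>)"
    proof (rule integral_norm_bound_integral)
      show "(\<lambda>\<zeta>. (f \<zeta> - f z) * of_real (?r z \<zeta>)) integrable_on ?Q" using i3 by blast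
      show "(\<lambda>\<zeta>. e * ?r z \<zeta>) integrable_on ?Q" using has_integral_mult_right[OF rc] by blast
      fix \<zeta> assume \<zeta>: "\<zeta> \<in> ?Q"
      show "norm ((f \<zeta> - f z) * of_real (?r z \<zeta>)) \<le> e * ?r z \<zeta>"
      proof (cases "?r z \<zeta> = 0")
        case False
        then have "\<bar>Re (\<zeta> - z)\<bar> \<le> \<epsilon>" "\<bar>Im (\<zeta> - z)\<bar> \<le> \<epsilon>"
          using d0(3) by (metis mult_eq_0_iff not_le)+
        then have "dist \<zeta> z \<le> 2 * \<epsilon>"
          using cmod_le[of "\<zeta> - z"] by (simp add: dist_norm)
        from e[OF \<zeta> this] have "cmod (f \<zeta> - f z) \<le> e" by (simp add: dist_norm)
        then show ?thesis
          using d0(1) by (simp add: norm_mult mult_right_mono abs_mult)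
      next
        case True
        then show ?thesis by (simp only: of_real_0 mult_zero_right norm_zero)
      qed
    qed
    also have "integral ?Q (\<lambda>\<zeta>. e * ?r z \<zeta>) = e * c"
      using has_integral_mult_right[OF rc] by blast
    also have "integral ?Q (\<lambda>\<zeta>. (f \<zeta> - f z) * of_real (?r z \<zeta>)) = ?F z - f z * of_real c"
      using i3 by blast
    finally have "norm (?F z - f z * of_real c) / c \<le> e"
      using c(1) by (simp add: field_simps)
    moreover have "norm (?F z - f z * of_real c) / c = norm ((?F z - f z * of_real c) / of_real c)"
      using c(1) by (simp add: norm_divide)
    moreover have "(?F z - f z * of_real c) / of_real c = ?F z / of_real c - f z"
      using c(1) by (simp add: diff_divide_distrib)
    ultimately show ?thesis by (simp add: dist_norm)
  qed
  ultimately show ?thesis by (rule that)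
qed

text \<open>
  Weyl's lemma for the Cauchy-Riemann operator. Near each point \<open>f\<close> is the uniform limit of its
  mollifications, by uniform continuity on a compact box.
\<close>

theorem continuous_weak_solution_holomorphic:
  fixes f :: "complex \<Rightarrow> complex"
  assumes f: "continuous_on unit_disc f" and weak: "annihilates_real_test_functions f"
  shows "f holomorphic_on unit_disc"
proof -
  have "\<exists>r>0. f holomorphic_on ball w r" if "w \<in> unit_disc" for w
  proof -
    have "open unit_disc" by simp
    with that obtain \<delta> where \<delta>: "\<delta> > 0" "cball w \<delta> \<subseteq> unit_disc"
      unfolding open_contains_cball by fast
    define a where "a = w - Complex (\<delta>/2) (\<delta>/2)"
    define b where "b = w + Complex (\<delta>/2) (\<delta>/2)"
    have Q: "\<zeta> \<in> cbox a b \<longleftrightarrow> \<bar>Re (\<zeta> - w)\<bar> \<le> \<delta>/2 \<and> \<bar>Im (\<zeta> - w)\<bar> \<le> \<delta>/2" for \<zeta>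
      unfolding in_cbox_complex_iff a_def b_def minus_complex.sel plus_complex.sel complex.sel abs_le_iff atLeastAtMost_iff
      by (intro iffI conjI; elim conjE; linarith)
    have "cbox a b \<subseteq> cball w \<delta>"
    proof
      fix \<zeta> assume "\<zeta> \<in> cbox a b"
      then show "\<zeta> \<in> cball w \<delta>"
        using cmod_le[of "\<zeta> - w"] unfolding Q by (auto simp: dist_norm norm_minus_commute)
    qed
    then have sub: "cbox a b \<subseteq> unit_disc" using \<delta> by auto
    \<comment> \<open>Centres within \<open>\<delta>/4\<close> of \<open>w\<close> and scales up to \<open>\<delta>/4\<close> keep the kernels inside the box of half side \<open>\<delta>/2\<close>.\<close>
    let ?U = "ball w (\<delta>/4)"
    define \<epsilon> where "\<epsilon> n = \<delta> / 4 * inverse (real (Suc n))" for n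
    have \<epsilon>: "\<epsilon> n > 0" "\<epsilon> n \<le> \<delta> / 4" for n
      using \<delta> by (auto simp: \<epsilon>_def field_simps)
    have UQ: "\<zeta> \<in> cbox a b" if z: "z \<in> ?U" and le: "\<bar>Re (\<zeta> - z)\<bar> \<le> \<delta>/4" "\<bar>Im (\<zeta> - z)\<bar> \<le> \<delta>/4" for z \<zeta>
    proof -
      have "\<bar>Re (z - w)\<bar> \<le> \<delta>/4" "\<bar>Im (z - w)\<bar> \<le> \<delta>/4"
        using abs_Re_le_cmod[of "z - w"] abs_Im_le_cmod[of "z - w"] z
        by (auto simp: dist_norm norm_minus_commute)
      with le show ?thesis
        unfolding Q minus_complex.sel abs_le_iff by (intro conjI; elim conjE; linarith)
    qed
    have "\<exists>g. g holomorphic_on ?U \<and>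
      (\<forall>z\<in>?U. \<forall>e. (\<forall>\<zeta>\<in>cbox a b. dist \<zeta> z \<le> 2 * \<epsilon> n \<longrightarrow> dist (f \<zeta>) (f z) \<le> e) \<longrightarrow> dist (g z) (f z) \<le> e)" for n
    proof -
      have "\<zeta> \<in> cbox a b" if "z \<in> ?U" "\<bar>Re (\<zeta> - z)\<bar> \<le> \<epsilon> n" "\<bar>Im (\<zeta> - z)\<bar> \<le> \<epsilon> n" for z \<zeta>
        by (rule UQ[OF that(1)]) (use that(2,3) \<epsilon>(2)[of n] in linarith)+
      then show ?thesis
        using holomorphic_approximation_of_weak_solution[OF f weak sub \<epsilon>(1)[of n] open_ball convex_ball, of w "\<delta>/4"]
        by metis
    qed
    then obtain g where g: "\<And>n. g n holomorphic_on ?U"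
      "\<And>n z e. z \<in> ?U \<Longrightarrow> (\<forall>\<zeta>\<in>cbox a b. dist \<zeta> z \<le> 2 * \<epsilon> n \<longrightarrow> dist (f \<zeta>) (f z) \<le> e) \<Longrightarrow> dist (g n z) (f z) \<le> e"
      by metis
    have "uniformly_continuous_on (cbox a b) f"
      by (intro compact_uniformly_continuous continuous_on_subset[OF f sub]) simp
    have ul: "uniform_limit ?U g f sequentially"
      unfolding uniform_limit_iff
    proof (intro allI impI)
      fix e :: real assume "e > 0"
      then obtain \<eta> where \<eta>: "\<eta> > 0" "\<And>x y. x \<in> cbox a b \<Longrightarrow> y \<in> cbox a b \<Longrightarrow> dist x y < \<eta> \<Longrightarrow> dist (f x) (f y) < e/2"
        using \<open>uniformly_continuous_on (cbox a b) f\<close> unfolding uniformly_continuous_on_def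
        by (metis half_gt_zero dist_commute)
      have "(\<lambda>n. 2 * \<epsilon> n) \<longlonglongrightarrow> 2 * (\<delta> / 4 * 0)"
        unfolding \<epsilon>_def by (intro tendsto_intros LIMSEQ_inverse_real_of_nat)
      then have "\<forall>\<^sub>F n in sequentially. 2 * \<epsilon> n < \<eta>"
        using \<eta>(1) by (intro order_tendstoD(2)) auto
      then show "\<forall>\<^sub>F n in sequentially. \<forall>z\<in>?U. dist (g n z) (f z) < e"
      proof eventually_elim
        case (elim n)
        show ?case
        proof
          fix z assume z: "z \<in> ?U"
          then have "z \<in> cbox a b" using UQ[of z z] \<delta> by simp
          then have "dist (g n z) (f z) \<le> e/2"
          proof (intro g(2) z ballI impI)
            fix \<zeta> assume "\<zeta> \<in> cbox a b" "dist \<zeta> z \<le> 2 * \<epsilon> n"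
            with \<eta>(2)[of \<zeta> z] \<open>z \<in> cbox a b\<close> elim show "dist (f \<zeta>) (f z) \<le> e/2" by linarith
          qed
          then show "dist (g n z) (f z) < e" using \<open>e > 0\<close> by simp
        qed
      qed
    qed
    have "f holomorphic_on ?U"
    proof (rule holomorphic_uniform_sequence[OF _ g(1)])
      fix x assume "x \<in> ?U"
      moreover have "open ?U" by simp
      ultimately obtain r where "r > 0" "cball x r \<subseteq> ?U"
        unfolding open_contains_cball by fast
      then show "\<exists>d>0. cball x d \<subseteq> ?U \<and> uniform_limit (cball x d) g f sequentially"
        using uniform_limit_on_subset[OF ul] by blast
    qed simp
    then show ?thesis using \<delta> by (intro exI[of _ "\<delta>/4"]) auto
  qed
  then show ?thesis
    by (metis analytic_imp_holomorphic analytic_on_def)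
qed

section \<open>Pairing power series with smooth functions on the circle\<close>

lemma integral_sums_of_dominated_series:
  fixes u :: "nat \<Rightarrow> real \<Rightarrow> complex"
  assumes "\<And>n. continuous_on {a..b} (u n)"
    and "\<And>n x. x \<in> {a..b} \<Longrightarrow> norm (u n x) \<le> M n" and "summable M"
  shows "(\<lambda>n. integral {a..b} (u n)) sums integral {a..b} (\<lambda>x. \<Sum>n. u n x)"
proof -
  have ul: "uniform_limit {a..b} (\<lambda>n x. \<Sum>i<n. u i x) (\<lambda>x. \<Sum>i. u i x) sequentially"
    by (rule Weierstrass_m_test) (use assms in auto)
  obtain I J where IJ: "\<And>n. ((\<lambda>x. \<Sum>i<n. u i x) has_integral I n) {a..b}"
    "((\<lambda>x. \<Sum>i. u i x) has_integral J) {a..b}" "I \<longlonglongrightarrow> J"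
    by (rule uniform_limit_integral[OF ul]) (auto intro!: continuous_intros assms)
  have "I n = (\<Sum>i<n. integral {a..b} (u i))" for n
  proof -
    have "I n = integral {a..b} (\<lambda>x. \<Sum>i<n. u i x)" using IJ(1) by (rule integral_unique[symmetric])
    also have "\<dots> = (\<Sum>i<n. integral {a..b} (u i))"
      by (rule integral_sum) (auto intro!: integrable_continuous_interval assms)
    finally show ?thesis .
  qed
  then have "I = (\<lambda>n. \<Sum>i<n. integral {a..b} (u i))" by auto
  with IJ(2,3) show ?thesis by (simp add: sums_def integral_unique)
qed

text \<open>
  Up to the factor \<open>2 \<pi>\<close> and the sign of the index, the Fourier coefficients of \<open>\<psi>\<close>; they are what a
  power series in \<open>z = r e\<^sup>i\<^sup>\<theta>\<close> sees of \<open>\<psi>\<close>.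
\<close>

definition circle_coeff :: "(real \<Rightarrow> complex) \<Rightarrow> nat \<Rightarrow> complex" where
  "circle_coeff \<psi> n = integral {0..2 * pi} (\<lambda>\<theta>. cis (real n * \<theta>) * \<psi> \<theta>)"

lemma continuous_on_cis_linear [continuous_intros]: "continuous_on S (\<lambda>\<theta>. cis (c * \<theta>))"
  by (simp add: cis_conv_exp) (intro continuous_intros)

lemma pairing_power_series:
  fixes g :: "complex \<Rightarrow> complex"
  assumes g: "\<And>z. norm z < 1 \<Longrightarrow> (\<lambda>n. a n * z ^ n) sums g z"
    and \<psi>: "continuous_on {0..2 * pi} \<psi>" and r: "0 \<le> r" "r < 1"
  shows "(\<lambda>n. a n * circle_coeff \<psi> n * of_real r ^ n) sums integral {0..2 * pi} (\<lambda>\<theta>. g (rcis r \<theta>) * \<psi> \<theta>)"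
proof -
  obtain B where B: "\<And>\<theta>. \<theta> \<in> {0..2 * pi} \<Longrightarrow> norm (\<psi> \<theta>) \<le> B"
    using compact_continuous_image[OF \<psi>] compact_imp_bounded[of "\<psi> ` {0..2 * pi}"]
    unfolding bounded_iff by (metis compact_Icc imageI)
  define t where "t = (1 + r) / 2"
  have t: "r < t" "t < 1" "0 < t" using r by (auto simp: t_def)
  have "summable (\<lambda>n. norm (a n * of_real r ^ n))"
    by (rule powser_insidea[OF sums_summable[OF g[of "of_real t"]]]) (use t r in auto)
  then have M: "summable (\<lambda>n. norm (a n * of_real r ^ n) * B)" by (rule summable_mult2)
  let ?u = "\<lambda>n \<theta>. a n * rcis r \<theta> ^ n * \<psi> \<theta>"
  have "(\<lambda>n. integral {0..2 * pi} (?u n)) sums integral {0..2 * pi} (\<lambda>\<theta>. \<Sum>n. ?u n \<theta>)"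
  proof (rule integral_sums_of_dominated_series[OF _ _ M])
    show "continuous_on {0..2 * pi} (?u n)" for n
      unfolding DeMoivre2 unfolding rcis_def by (intro continuous_intros \<psi>)
    show "norm (?u n \<theta>) \<le> norm (a n * of_real r ^ n) * B" if "\<theta> \<in> {0..2 * pi}" for n \<theta>
      using B[OF that] r by (auto simp: norm_mult norm_power intro!: mult_left_mono)
  qed
  moreover have "integral {0..2 * pi} (?u n) = a n * circle_coeff \<psi> n * of_real r ^ n" for n
  proof -
    have eq: "?u n = (\<lambda>\<theta>. (a n * of_real r ^ n) * (cis (real n * \<theta>) * \<psi> \<theta>))"
      unfolding DeMoivre2 unfolding rcis_def by (auto simp: fun_eq_iff algebra_simps)
    have "integral {0..2 * pi} (?u n) = (a n * of_real r ^ n) * circle_coeff \<psi> n"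
      unfolding eq circle_coeff_def by (rule integral_mult_right)
    then show ?thesis by (simp only: mult_ac)
  qed
  moreover have "(\<Sum>n. ?u n \<theta>) = g (rcis r \<theta>) * \<psi> \<theta>" for \<theta>
    using sums_mult2[OF g[of "rcis r \<theta>"]] r by (auto intro!: sums_unique[symmetric])
  ultimately show ?thesis by simp
qed

text \<open>
  The derivatives of a periodic function are periodic, by uniqueness of derivatives; the boundary
  terms in the integrations by parts cancel for this reason.
\<close>

lemma smooth_circleE:
  assumes "\<psi> \<in> smooth_circle"
  obtains d where "d 0 = \<psi>" "\<And>n \<theta>. (d n has_vector_derivative d (Suc n) \<theta>) (at \<theta>)"
    "\<And>n \<theta>. d n (\<theta> + 2 * pi) = d n \<theta>" "\<And>n S. continuous_on S (d n)"
proof -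
  obtain d where d: "d 0 = \<psi>" "\<And>n \<theta>. (d n has_vector_derivative d (Suc n) \<theta>) (at \<theta>)"
    and per: "\<And>\<theta>. \<psi> (\<theta> + 2 * pi) = \<psi> \<theta>"
    using assms by (auto simp: smooth_circle_def)
  have p: "d n (\<theta> + 2 * pi) = d n \<theta>" for n \<theta>
  proof (induction n arbitrary: \<theta>)
    case (Suc n)
    have "((d n \<circ> (\<lambda>\<theta>. \<theta> + 2 * pi)) has_vector_derivative (1 *\<^sub>R d (Suc n) (\<theta> + 2 * pi))) (at \<theta>)"
      by (rule vector_diff_chain_at) (auto intro!: derivative_eq_intros d)
    moreover have "d n \<circ> (\<lambda>\<theta>. \<theta> + 2 * pi) = d n" using Suc by auto
    ultimately have "(d n has_vector_derivative d (Suc n) (\<theta> + 2 * pi)) (at \<theta>)" by simp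
    then show ?case by (rule vector_derivative_unique_at[OF _ d(2)])
  qed (simp add: d per)
  have c: "continuous_on S (d n)" for n S
    by (intro continuous_at_imp_continuous_on ballI has_vector_derivative_continuous[OF d(2)])
  show ?thesis by (rule that[of d, OF d p c])
qed

lemma circle_coeff_derivative:
  assumes d: "\<And>\<theta>. (\<psi> has_vector_derivative \<psi>' \<theta>) (at \<theta>)" and per: "\<psi> (2 * pi) = \<psi> 0"
    and cont: "continuous_on {0..2 * pi} \<psi>" "continuous_on {0..2 * pi} \<psi>'"
  shows "circle_coeff \<psi>' n = - (\<i> * of_nat n) * circle_coeff \<psi> n"
proof -
  have "((\<lambda>\<theta>. cis (real n * \<theta>) * \<psi>' \<theta> + (\<i> * of_nat n) * (cis (real n * \<theta>) * \<psi> \<theta>)) has_integral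
      (cis (real n * (2 * pi)) * \<psi> (2 * pi) - cis (real n * 0) * \<psi> 0)) {0..2 * pi}"
  proof (rule fundamental_theorem_of_calculus)
    fix \<theta> assume "\<theta> \<in> {0..2 * pi}"
    have "((\<lambda>\<theta>. cis (real n * \<theta>)) has_vector_derivative \<i> * of_nat n * cis (real n * \<theta>)) (at \<theta>)"
    proof -
      have "((\<lambda>\<theta>. cis (real n * \<theta>)) has_derivative (\<lambda>t. (real n * t) *\<^sub>R (\<i> * cis (real n * \<theta>)))) (at \<theta>)"
        by (rule has_derivative_cis) (auto intro!: derivative_eq_intros)
      then show ?thesis
        unfolding has_vector_derivative_def
        by (rule has_derivative_eq_rhs) (auto simp: scaleR_conv_of_real)
    qed
    from has_vector_derivative_mult[OF this d]
    have "((\<lambda>\<theta>. cis (real n * \<theta>) * \<psi> \<theta>) has_vector_derivative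
      cis (real n * \<theta>) * \<psi>' \<theta> + (\<i> * of_nat n) * (cis (real n * \<theta>) * \<psi> \<theta>)) (at \<theta>)"
      by (simp only: mult.assoc)
    then show "((\<lambda>\<theta>. cis (real n * \<theta>) * \<psi> \<theta>) has_vector_derivative
      cis (real n * \<theta>) * \<psi>' \<theta> + (\<i> * of_nat n) * (cis (real n * \<theta>) * \<psi> \<theta>)) (at \<theta> within {0..2 * pi})"
      by (rule has_vector_derivative_at_within)
  qed simp
  moreover have "cis (real n * (2 * pi)) = 1"
    using cis_multiple_2pi[of n] by (simp add: mult_ac)
  ultimately have "((\<lambda>\<theta>. cis (real n * \<theta>) * \<psi>' \<theta> + (\<i> * of_nat n) * (cis (real n * \<theta>) * \<psi> \<theta>)) has_integral 0) {0..2 * pi}"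
    by (simp add: per)
  then have "integral {0..2 * pi} (\<lambda>\<theta>. cis (real n * \<theta>) * \<psi>' \<theta> + (\<i> * of_nat n) * (cis (real n * \<theta>) * \<psi> \<theta>)) = 0"
    by (rule integral_unique)
  then have "circle_coeff \<psi>' n + (\<i> * of_nat n) * circle_coeff \<psi> n = 0"
    unfolding circle_coeff_def
    by (subst (asm) integral_add) (auto intro!: integrable_continuous_interval continuous_intros cont)
  then show ?thesis by (simp add: eq_neg_iff_add_eq_0)
qed

lemma circle_coeff_bounded:
  assumes "continuous_on {0..2 * pi} \<psi>"
  obtains B where "B \<ge> 0" "\<And>n. norm (circle_coeff \<psi> n) \<le> B"
proof -
  obtain B where B: "\<And>\<theta>. \<theta> \<in> {0..2 * pi} \<Longrightarrow> norm (\<psi> \<theta>) \<le> B"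
    using compact_continuous_image[OF assms] compact_imp_bounded[of "\<psi> ` {0..2 * pi}"]
    unfolding bounded_iff by (metis compact_Icc imageI)
  have "norm (circle_coeff \<psi> n) \<le> B * (2 * pi - 0)" for n
    unfolding circle_coeff_def
    by (rule integral_bound) (auto intro!: continuous_intros assms B simp: norm_mult)
  moreover have "B \<ge> 0" using order_trans[OF norm_ge_zero B[of 0]] by simp
  ultimately show ?thesis using that[of "B * (2 * pi - 0)"] by simp
qed

text \<open>
  Each of \<open>k\<close> integrations by parts gains a factor \<open>1 / n\<close>, and the coefficients of the \<open>k\<close>-th
  derivative are bounded.
\<close>

lemma circle_coeff_rapidly_decreasing:
  assumes "\<psi> \<in> smooth_circle"
  obtains K where "\<And>n. norm (circle_coeff \<psi> n) * (real n + 1) ^ k \<le> K"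
proof -
  obtain d where d: "d 0 = \<psi>" "\<And>n \<theta>. (d n has_vector_derivative d (Suc n) \<theta>) (at \<theta>)"
    "\<And>n \<theta>. d n (\<theta> + 2 * pi) = d n \<theta>" "\<And>n S. continuous_on S (d n)"
    by (rule smooth_circleE[OF assms]) (rule that)
  have dk: "norm (circle_coeff (d k) n) = real n ^ k * norm (circle_coeff \<psi> n)" for k n
  proof (induction k)
    case (Suc k)
    have "circle_coeff (d (Suc k)) n = - (\<i> * of_nat n) * circle_coeff (d k) n"
      using circle_coeff_derivative[OF d(2) _ d(4) d(4)] d(3)[of k 0] by simp
    then show ?case using Suc by (simp add: norm_mult)
  qed (simp add: d)
  obtain B0 where B0: "B0 \<ge> 0" "\<And>n. norm (circle_coeff (d 0) n) \<le> B0"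
    by (rule circle_coeff_bounded[OF d(4)]) (rule that)
  obtain Bk where Bk: "Bk \<ge> 0" "\<And>n. norm (circle_coeff (d k) n) \<le> Bk"
    by (rule circle_coeff_bounded[OF d(4)]) (rule that)
  have "norm (circle_coeff \<psi> n) * (real n + 1) ^ k \<le> 2 ^ k * (B0 + Bk)" for n
  proof (cases "n = 0")
    case True
    have "1 * B0 \<le> 2 ^ k * (B0 + Bk)" using B0(1) Bk(1) by (intro mult_mono) auto
    then show ?thesis using True B0(2)[of 0] d(1) by simp
  next
    case False
    then have "(real n + 1) ^ k \<le> (2 * real n) ^ k" by (intro power_mono) auto
    then have "norm (circle_coeff \<psi> n) * (real n + 1) ^ k \<le> norm (circle_coeff \<psi> n) * (2 * real n) ^ k"
      by (intro mult_left_mono) auto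
    also have "\<dots> = 2 ^ k * norm (circle_coeff (d k) n)"
      by (simp add: dk power_mult_distrib)
    also have "\<dots> \<le> 2 ^ k * (B0 + Bk)"
      using B0(1) Bk(2)[of n] by (intro mult_left_mono) auto
    finally show ?thesis .
  qed
  then show ?thesis by (rule that)
qed

definition polynomially_bounded :: "(nat \<Rightarrow> complex) \<Rightarrow> bool" where
  "polynomially_bounded a \<longleftrightarrow> (\<exists>K m. \<forall>n. norm (a n) \<le> K * (real n + 1) ^ m)"

lemma summable_inverse_square_shifted: "summable (\<lambda>n. 1 / (real n + 1) ^ 2)"
proof -
  have "summable (\<lambda>n. inverse (real (Suc n) ^ 2))"
    using inverse_power_summable[of 2] summable_Suc_iff[of "\<lambda>n. inverse (real n ^ 2)"] by simp
  then show ?thesis by (simp add: add.commute inverse_eq_divide)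
qed

text \<open>
  With \<open>|a\<^sub>n| \<le> K (n + 1)\<^sup>m\<close> and \<open>|c\<^sub>n| \<le> K' (n + 1)\<^sup>-\<^sup>m\<^sup>-\<^sup>2\<close> the series for the pairing is dominated by
  \<open>\<Sum> (n + 1)\<^sup>-\<^sup>2\<close> on all of \<open>[0, 1]\<close>, hence continuous up to \<open>r = 1\<close>.
\<close>

lemma pairing_converges:
  fixes g :: "complex \<Rightarrow> complex"
  assumes g: "\<And>z. norm z < 1 \<Longrightarrow> (\<lambda>n. a n * z ^ n) sums g z"
    and a: "polynomially_bounded a" and \<psi>: "\<psi> \<in> smooth_circle"
  shows "\<exists>L. ((\<lambda>r. integral {0..2 * pi} (\<lambda>\<theta>. g (rcis r \<theta>) * \<psi> \<theta>)) \<longlongrightarrow> L) (at_left 1)"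
proof -
  obtain K m where K: "\<And>n. norm (a n) \<le> K * (real n + 1) ^ m"
    using a by (auto simp: polynomially_bounded_def)
  have K0: "K \<ge> 0" using order_trans[OF norm_ge_zero K[of 0]] by simp
  obtain K' where K': "\<And>n. norm (circle_coeff \<psi> n) * (real n + 1) ^ (m + 2) \<le> K'"
    by (rule circle_coeff_rapidly_decreasing[OF \<psi>, where k = "m + 2"]) (rule that)
  let ?F = "\<lambda>r. \<Sum>n. a n * circle_coeff \<psi> n * complex_of_real r ^ n"
  have bound: "norm (a n * circle_coeff \<psi> n * complex_of_real r ^ n) \<le> K * K' * (1 / (real n + 1) ^ 2)"
    if "r \<in> {0..1}" for r n
  proof -
    have "norm (a n * circle_coeff \<psi> n * complex_of_real r ^ n) \<le> norm (a n) * norm (circle_coeff \<psi> n) * 1"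
      using that unfolding norm_mult by (intro mult_left_mono) (auto simp: norm_power power_le_one)
    also have "\<dots> \<le> (K * (real n + 1) ^ m) * (K' / (real n + 1) ^ (m + 2)) * 1"
    proof -
      have p: "0 < (real n + 1) ^ (m + 2)" by simp
      have "norm (circle_coeff \<psi> n) \<le> K' / (real n + 1) ^ (m + 2)"
        using pos_le_divide_eq[OF p] K'[of n] by blast
      then show ?thesis
        using K0 K[of n] by (intro mult_right_mono mult_mono) auto
    qed
    also have "\<dots> = K * K' * (1 / (real n + 1) ^ 2)"
      unfolding power_add by simp
    finally show ?thesis .
  qed
  have "uniform_limit {0..1} (\<lambda>n r. \<Sum>i<n. a i * circle_coeff \<psi> i * complex_of_real r ^ i) ?F sequentially"
    by (rule Weierstrass_m_test[OF bound summable_mult[OF summable_inverse_square_shifted]])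
  then have "continuous_on {0..1} ?F"
    by (rule uniform_limit_theorem[rotated]) (auto intro!: always_eventually continuous_intros)
  then have "(?F \<longlongrightarrow> ?F 1) (at 1 within {0..1})"
    unfolding continuous_on_def by (rule bspec) simp
  then have "(?F \<longlongrightarrow> ?F 1) (at_left 1)"
    by (simp only: at_within_Icc_at_left[OF zero_less_one])
  moreover have "\<forall>\<^sub>F r in at_left 1. ?F r = integral {0..2 * pi} (\<lambda>\<theta>. g (rcis r \<theta>) * \<psi> \<theta>)"
  proof -
    have "\<forall>\<^sub>F r in at_left (1::real). r \<in> {0<..<1}"
      by (rule eventually_at_left_real) simp
    then show ?thesis
    proof eventually_elim
      case (elim r)
      have "continuous_on {0..2 * pi} \<psi>" by (rule smooth_circleE[OF \<psi>]) blast
      then have "(\<lambda>n. a n * circle_coeff \<psi> n * complex_of_real r ^ n) sums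
          integral {0..2 * pi} (\<lambda>\<theta>. g (rcis r \<theta>) * \<psi> \<theta>)"
        using elim by (intro pairing_power_series[OF g]) simp_all
      then show ?case by (rule sums_unique[symmetric])
    qed
  qed
  ultimately show ?thesis by (intro exI) (rule Lim_transform_eventually)
qed

section \<open>Growth of a power series and of its coefficients\<close>

text \<open>
  Cauchy's estimate on the radius \<open>r = (n + 1) / (n + 2)\<close>: there \<open>1 / (1 - r) = n + 2\<close>, while \<open>r\<^sup>-\<^sup>n\<close>
  stays below \<open>e\<close>.
\<close>

lemma Taylor_coeffs_polynomially_bounded:
  fixes g :: "complex \<Rightarrow> complex"
  assumes hol: "g holomorphic_on unit_disc"
    and bound: "\<And>z. norm z < 1 \<Longrightarrow> norm (g z) \<le> C / (1 - norm z) powr \<alpha>"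
  shows "polynomially_bounded (\<lambda>n. (deriv ^^ n) g 0 / fact n)"
proof -
  obtain m :: nat where m: "\<alpha> \<le> real m" using real_arch_simple by blast
  have C0: "C \<ge> 0" using order_trans[OF norm_ge_zero bound[of 0]] by simp
  have "norm ((deriv ^^ n) g 0 / fact n) \<le> C * 2 ^ m * exp 1 * (real n + 1) ^ m" for n
  proof -
    define r where "r = (real n + 1) / (real n + 2)"
    have r: "0 < r" "r < 1" "1 - r = 1 / (real n + 2)" by (auto simp: r_def field_simps)
    have "norm ((deriv ^^ n) g 0) \<le> fact n * (C * (real n + 2) powr \<alpha>) / r ^ n"
    proof (rule Cauchy_inequality)
      show "g holomorphic_on ball 0 r" by (rule holomorphic_on_subset[OF hol]) (use r in auto)
      show "continuous_on (cball 0 r) g"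
        by (rule continuous_on_subset[OF holomorphic_on_imp_continuous_on[OF hol]]) (use r in auto)
      fix x :: complex assume "norm (0 - x) = r"
      then have "norm (g x) \<le> C / (1 / (real n + 2)) powr \<alpha>" using bound[of x] r by simp
      then show "norm (g x) \<le> C * (real n + 2) powr \<alpha>" by (simp add: powr_divide)
    qed (use r in auto)
    then have 1: "norm ((deriv ^^ n) g 0 / fact n) \<le> C * (real n + 2) powr \<alpha> * inverse (r ^ n)"
      by (simp add: norm_divide field_simps)
    have "inverse r = 1 + 1 / (real n + 1)" by (simp add: r_def field_simps)
    also have "\<dots> \<le> exp (1 / (real n + 1))" by (rule exp_ge_add_one_self)
    finally have "inverse r ^ n \<le> exp (1 / (real n + 1)) ^ n" using r by (intro power_mono) auto
    also have "\<dots> = exp (real n * (1 / (real n + 1)))" by (rule exp_of_nat_mult[symmetric])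
    also have "\<dots> \<le> exp 1" by (simp add: field_simps)
    finally have 2: "inverse (r ^ n) \<le> exp 1" by (simp add: power_inverse)
    have "(real n + 2) powr \<alpha> \<le> (real n + 2) powr real m" using m by (intro powr_mono) auto
    also have "\<dots> = (real n + 2) ^ m" by (simp add: powr_realpow)
    also have "\<dots> \<le> (2 * (real n + 1)) ^ m" by (intro power_mono) auto
    finally have 3: "(real n + 2) powr \<alpha> \<le> 2 ^ m * (real n + 1) ^ m" by (simp only: power_mult_distrib)
    have "C * (real n + 2) powr \<alpha> * inverse (r ^ n) \<le> C * (2 ^ m * (real n + 1) ^ m) * exp 1"
      using 2 3 C0 r by (intro mult_mono mult_nonneg_nonneg) auto
    with 1 show ?thesis by (simp add: mult_ac)
  qed
  then show ?thesis unfolding polynomially_bounded_def by blast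
qed

lemma power_le_fact_exp:
  fixes x :: real
  assumes "x \<ge> 0"
  shows "x ^ m \<le> fact m * exp x"
proof -
  have "x ^ m / fact m = (\<Sum>k\<in>{m}. x ^ k /\<^sub>R fact k)" by (simp add: divide_inverse mult.commute)
  also have "\<dots> \<le> (\<Sum>k. x ^ k /\<^sub>R fact k)"
    by (rule sum_le_suminf) (use assms in \<open>auto intro: summable_exp\<close>)
  also have "\<dots> = exp x" by (simp add: exp_def)
  finally show ?thesis by (simp add: field_simps)
qed

text \<open>
  Half of the decay of \<open>r\<^sup>n \<le> exp(- 2 s n)\<close> is spent on the polynomial factor, through
  \<open>((n + 1) s)\<^sup>m \<le> m! exp((n + 1) s)\<close>. The other half leaves a geometric series of sum at most \<open>2 / s\<close>.
\<close>

lemma polynomial_times_power_sum_bound: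
  fixes r :: real
  assumes "0 \<le> r" "r < 1"
  defines "s \<equiv> (1 - r) / 2"
  shows "summable (\<lambda>n. (real n + 1) ^ m * r ^ n)"
    "(\<Sum>n. (real n + 1) ^ m * r ^ n) \<le> 2 ^ (m + 2) * fact m * exp 1 / (1 - r) ^ (m + 1)"
proof -
  have s: "0 < s" "s \<le> 1/2" using assms by (auto simp: s_def)
  have exps: "norm (exp (- s)) < 1" using s by simp
  have bound: "(real n + 1) ^ m * r ^ n \<le> fact m * exp 1 / s ^ m * exp (- s) ^ n" for n
  proof -
    have "r \<le> exp (- (2 * s))"
    proof -
      have "1 + - (2 * s) = r" by (simp add: s_def field_simps)
      with exp_ge_add_one_self[of "- (2 * s)"] show ?thesis by simp
    qed
    then have "r ^ n \<le> exp (- (2 * s)) ^ n" using assms by (intro power_mono) auto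
    also have "\<dots> = exp (- (2 * s * real n))" by (simp add: exp_of_nat_mult[symmetric] mult_ac)
    finally have 1: "r ^ n \<le> exp (- (2 * s * real n))" .
    have "((real n + 1) * s) ^ m \<le> fact m * exp ((real n + 1) * s)"
      using s by (intro power_le_fact_exp) auto
    then have "(real n + 1) ^ m * s ^ m \<le> fact m * exp ((real n + 1) * s)"
      by (simp only: power_mult_distrib)
    then have 2: "(real n + 1) ^ m \<le> fact m * exp ((real n + 1) * s) / s ^ m"
      using pos_le_divide_eq[of "s ^ m"] s by simp
    have "(real n + 1) ^ m * r ^ n \<le> fact m * exp ((real n + 1) * s) / s ^ m * exp (- (2 * s * real n))"
      using 1 2 assms s by (intro mult_mono) auto
    also have "\<dots> = fact m / s ^ m * exp ((real n + 1) * s + - (2 * s * real n))"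
      unfolding exp_add by simp
    also have "\<dots> \<le> fact m / s ^ m * exp (1 + real n * (- s))"
      using s by (intro mult_left_mono) (auto simp: algebra_simps)
    also have "\<dots> = fact m * exp 1 / s ^ m * exp (- s) ^ n"
      by (simp only: exp_add exp_of_nat_mult) simp
    finally show ?thesis .
  qed
  have geo: "summable (\<lambda>n. fact m * exp 1 / s ^ m * exp (- s) ^ n)"
    by (intro summable_mult summable_geometric exps)
  show sm: "summable (\<lambda>n. (real n + 1) ^ m * r ^ n)"
    by (rule summable_comparison_test'[OF geo]) (use bound assms in auto)
  have "(\<Sum>n. (real n + 1) ^ m * r ^ n) \<le> (\<Sum>n. fact m * exp 1 / s ^ m * exp (- s) ^ n)"
    by (rule suminf_le[OF bound sm geo])
  also have "\<dots> = fact m * exp 1 / s ^ m * (1 / (1 - exp (- s)))"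
    by (subst suminf_mult[OF summable_geometric[OF exps]]) (simp add: suminf_geometric[OF exps])
  also have "\<dots> \<le> fact m * exp 1 / s ^ m * (2 / s)"
  proof (rule mult_left_mono)
    have "1 + s \<le> exp s" by (rule exp_ge_add_one_self)
    then have "exp (- s) \<le> 1 / (1 + s)"
      using s by (simp add: exp_minus inverse_eq_divide frac_le)
    then have "s / (1 + s) \<le> 1 - exp (- s)" using s by (simp add: field_simps)
    moreover have "s / 2 \<le> s / (1 + s)" using s by (intro divide_left_mono) auto
    ultimately have "s / 2 \<le> 1 - exp (- s)" by linarith
    then have "1 / (1 - exp (- s)) \<le> 1 / (s / 2)" using s by (intro divide_left_mono) auto
    then show "1 / (1 - exp (- s)) \<le> 2 / s" by simp
  qed (use s in auto)
  also have "\<dots> = 2 ^ (m + 2) * fact m * exp 1 / (1 - r) ^ (m + 1)"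
    using assms by (simp add: s_def power_divide field_simps)
  finally show "(\<Sum>n. (real n + 1) ^ m * r ^ n) \<le> 2 ^ (m + 2) * fact m * exp 1 / (1 - r) ^ (m + 1)" .
qed

lemma power_series_growth:
  fixes g :: "complex \<Rightarrow> complex"
  assumes g: "\<And>z. norm z < 1 \<Longrightarrow> (\<lambda>n. a n * z ^ n) sums g z" and a: "polynomially_bounded a"
  obtains C \<alpha> where "C > 0" "\<alpha> \<ge> 0" "\<And>z. norm z < 1 \<Longrightarrow> norm (g z) \<le> C / (1 - norm z) powr \<alpha>"
proof -
  obtain K m where K: "\<And>n. norm (a n) \<le> K * (real n + 1) ^ m"
    using a by (auto simp: polynomially_bounded_def)
  have K0: "K \<ge> 0" using order_trans[OF norm_ge_zero K[of 0]] by simp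
  define c where "c = 2 ^ (m + 2) * fact m * exp (1::real)"
  have "norm (g z) \<le> (K * c + 1) / (1 - norm z) powr real (m + 1)" if z: "norm z < 1" for z
  proof -
    have b: "norm (a n * z ^ n) \<le> K * ((real n + 1) ^ m * norm z ^ n)" for n
      using K[of n] by (auto simp: norm_mult norm_power mult.assoc[symmetric] intro!: mult_right_mono)
    have sm: "summable (\<lambda>n. K * ((real n + 1) ^ m * norm z ^ n))"
      using polynomial_times_power_sum_bound(1)[of "norm z" m] z by (intro summable_mult) auto
    have sn: "summable (\<lambda>n. norm (a n * z ^ n))"
      by (rule summable_comparison_test'[OF sm]) (use b in auto)
    have "norm (g z) = norm (\<Sum>n. a n * z ^ n)" using sums_unique[OF g[OF z]] by simp
    also have "\<dots> \<le> (\<Sum>n. norm (a n * z ^ n))" by (rule summable_norm[OF sn])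
    also have "\<dots> \<le> (\<Sum>n. K * ((real n + 1) ^ m * norm z ^ n))" by (rule suminf_le[OF b sn sm])
    also have "\<dots> = K * (\<Sum>n. (real n + 1) ^ m * norm z ^ n)"
      by (rule suminf_mult) (use polynomial_times_power_sum_bound(1)[of "norm z" m] z in auto)
    also have "\<dots> \<le> K * (c / (1 - norm z) ^ (m + 1))"
      using polynomial_times_power_sum_bound(2)[of "norm z" m] z K0 by (intro mult_left_mono) (auto simp: c_def)
    also have "\<dots> \<le> (K * c + 1) / (1 - norm z) ^ (m + 1)"
      using z by (simp add: divide_right_mono)
    also have "(1 - norm z) ^ (m + 1) = (1 - norm z) powr real (m + 1)"
      by (rule powr_realpow[symmetric]) (use z in simp)
    finally show ?thesis .
  qed
  moreover have "K * c + 1 > 0" using K0 by (auto simp: c_def intro!: add_nonneg_pos)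
  ultimately show ?thesis by (intro that[of "K * c + 1" "real (m + 1)"]) auto
qed

section \<open>Test functions that detect superpolynomial coefficients\<close>

text \<open>
  Termwise differentiation, the differentiated series being dominated uniformly in \<open>\<theta>\<close>. Frequencies
  are negated so that the coefficient \<open>e\<^sub>n\<close> is the one that pairs with \<open>z\<^sup>n\<close>.
\<close>

lemma exponential_series_vector_derivative:
  fixes e :: "nat \<Rightarrow> complex"
  assumes "summable (\<lambda>n. norm (e n))" and "summable (\<lambda>n. norm (- (\<i> * of_nat n) * e n))"
  shows "((\<lambda>\<theta>. \<Sum>n. e n * cis (- (real n * \<theta>))) has_vector_derivative
    (\<Sum>n. (- (\<i> * of_nat n) * e n) * cis (- (real n * \<theta>)))) (at \<theta>)"
proof -
  let ?f = "\<lambda>n \<theta>. e n * cis (- (real n * \<theta>))"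
  let ?v = "\<lambda>n \<theta>. (- (\<i> * of_nat n) * e n) * cis (- (real n * \<theta>))"
  have sm: "summable (\<lambda>n. ?f n \<theta>)" for \<theta>
    by (rule summable_norm_cancel) (use assms(1) in \<open>simp add: norm_mult\<close>)
  have ul: "uniform_limit UNIV (\<lambda>n \<theta>. \<Sum>i<n. ?v i \<theta>) (\<lambda>\<theta>. \<Sum>i. ?v i \<theta>) sequentially"
    by (rule Weierstrass_m_test[OF _ assms(2)]) (simp add: norm_mult)
  have "\<exists>g. \<forall>\<theta>\<in>UNIV. (\<lambda>n. ?f n \<theta>) sums g \<theta> \<and> (g has_derivative (\<lambda>h. h *\<^sub>R (\<Sum>i. ?v i \<theta>))) (at \<theta> within UNIV)"
  proof (rule has_derivative_series[where f' = "\<lambda>n \<theta> h. h *\<^sub>R ?v n \<theta>" and x = 0 and l = "\<Sum>n. ?f n 0"])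
    fix n \<theta>
    have "((\<lambda>\<theta>. cis (- (real n * \<theta>))) has_derivative (\<lambda>t. (- (real n * t)) *\<^sub>R (\<i> * cis (- (real n * \<theta>))))) (at \<theta>)"
      by (rule has_derivative_cis) (auto intro!: derivative_eq_intros)
    then have "(?f n has_derivative (\<lambda>t. e n * ((- (real n * t)) *\<^sub>R (\<i> * cis (- (real n * \<theta>)))))) (at \<theta>)"
      by (rule has_derivative_mult_right)
    then show "(?f n has_derivative (\<lambda>h. h *\<^sub>R ?v n \<theta>)) (at \<theta> within UNIV)"
      by (rule has_derivative_eq_rhs) (auto simp: scaleR_conv_of_real)
  next
    fix \<epsilon> :: real assume "\<epsilon> > 0"
    from uniform_limitD[OF ul this]
    show "\<forall>\<^sub>F n in sequentially. \<forall>\<theta>\<in>UNIV. \<forall>h. norm ((\<Sum>i<n. h *\<^sub>R ?v i \<theta>) - h *\<^sub>R (\<Sum>i. ?v i \<theta>)) \<le> \<epsilon> * norm h"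
    proof eventually_elim
      case (elim n)
      have "norm ((\<Sum>i<n. h *\<^sub>R ?v i \<theta>) - h *\<^sub>R (\<Sum>i. ?v i \<theta>)) \<le> \<epsilon> * norm h" for h \<theta>
      proof -
        have "(\<Sum>i<n. h *\<^sub>R ?v i \<theta>) - h *\<^sub>R (\<Sum>i. ?v i \<theta>) = h *\<^sub>R ((\<Sum>i<n. ?v i \<theta>) - (\<Sum>i. ?v i \<theta>))"
          by (simp only: scaleR_sum_right scaleR_diff_right)
        moreover have "norm ((\<Sum>i<n. ?v i \<theta>) - (\<Sum>i. ?v i \<theta>)) \<le> \<epsilon>"
          using elim by (auto simp: dist_norm intro: less_imp_le)
        ultimately show ?thesis
          by (simp only: norm_scaleR real_norm_def mult.commute[of \<epsilon>] mult_left_mono abs_ge_zero)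
      qed
      then show ?case by blast
    qed
  qed (use summable_sums[OF sm[of 0]] in simp_all)
  then obtain g where g: "\<And>\<theta>. (\<lambda>n. ?f n \<theta>) sums g \<theta>" "\<And>\<theta>. (g has_derivative (\<lambda>h. h *\<^sub>R (\<Sum>i. ?v i \<theta>))) (at \<theta>)"
    by auto
  have "g = (\<lambda>\<theta>. \<Sum>n. ?f n \<theta>)" using g(1) sums_unique by blast
  with g(2) show ?thesis by (simp add: has_vector_derivative_def)
qed

lemma integral_cis_int_multiple:
  "integral {0..2 * pi} (\<lambda>\<theta>. cis (real n * \<theta>) * cis (- (real k * \<theta>))) = (if n = k then of_real (2 * pi) else 0)"
proof (cases "n = k")
  case True
  then show ?thesis by (simp add: cis_mult scaleR_conv_of_real)
next
  case False
  define j where "j = int n - int k"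
  have j: "j \<noteq> 0" using False by (simp add: j_def)
  have eq: "(\<lambda>\<theta>. cis (real n * \<theta>) * cis (- (real k * \<theta>))) = (\<lambda>\<theta>. cis (of_int j * \<theta>))"
    by (auto simp: cis_mult j_def algebra_simps)
  have "((\<lambda>\<theta>. cis (of_int j * \<theta>)) has_integral
      (cis (of_int j * (2 * pi)) / (\<i> * of_int j) - cis (of_int j * 0) / (\<i> * of_int j))) {0..2 * pi}"
  proof (rule fundamental_theorem_of_calculus)
    fix \<theta> assume "\<theta> \<in> {0..2 * pi}"
    have "((\<lambda>\<theta>. cis (of_int j * \<theta>)) has_derivative (\<lambda>t. (of_int j * t) *\<^sub>R (\<i> * cis (of_int j * \<theta>)))) (at \<theta> within {0..2 * pi})"
      by (rule has_derivative_cis) (auto intro!: derivative_eq_intros)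
    then have "((\<lambda>\<theta>. cis (of_int j * \<theta>) * inverse (\<i> * of_int j)) has_derivative
        (\<lambda>t. (of_int j * t) *\<^sub>R (\<i> * cis (of_int j * \<theta>)) * inverse (\<i> * of_int j))) (at \<theta> within {0..2 * pi})"
      by (rule has_derivative_mult_left)
    moreover have "(\<lambda>t. (of_int j * t) *\<^sub>R (\<i> * cis (of_int j * \<theta>)) * inverse (\<i> * of_int j)) = (\<lambda>t. t *\<^sub>R cis (of_int j * \<theta>))"
      using j by (auto simp: scaleR_conv_of_real fun_eq_iff field_simps)
    ultimately show "((\<lambda>\<theta>. cis (of_int j * \<theta>) / (\<i> * of_int j)) has_vector_derivative cis (of_int j * \<theta>)) (at \<theta> within {0..2 * pi})"
      unfolding has_vector_derivative_def divide_inverse by simp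
  qed simp
  moreover have "cis (of_int j * (2 * pi)) = 1"
    using cis_multiple_2pi[of "of_int j"] by (simp add: mult_ac)
  ultimately show ?thesis
    using False unfolding eq by (auto intro: integral_unique)
qed

definition rapidly_decreasing :: "(nat \<Rightarrow> complex) \<Rightarrow> bool" where
  "rapidly_decreasing e \<longleftrightarrow> (\<forall>m. \<exists>K. \<forall>n. norm (e n) * (real n + 1) ^ m \<le> K)"

lemma rapidly_decreasing_summable:
  assumes "rapidly_decreasing e"
  shows "summable (\<lambda>n. norm ((- (\<i> * of_nat n)) ^ m * e n))"
proof -
  obtain K where K: "\<And>n. norm (e n) * (real n + 1) ^ (m + 2) \<le> K"
    using assms unfolding rapidly_decreasing_def by blast
  have "norm (norm ((- (\<i> * of_nat n)) ^ m * e n)) \<le> K * (1 / (real n + 1) ^ 2)" for n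
  proof -
    have "norm ((- (\<i> * of_nat n)) ^ m * e n) = real n ^ m * norm (e n)"
      by (simp add: norm_mult norm_power)
    also have "\<dots> \<le> (real n + 1) ^ m * norm (e n)"
      by (intro mult_right_mono power_mono) auto
    also have "\<dots> = norm (e n) * (real n + 1) ^ (m + 2) / (real n + 1) ^ 2"
      unfolding power_add by simp
    also have "\<dots> \<le> K / (real n + 1) ^ 2"
      by (rule divide_right_mono[OF K]) simp
    finally show ?thesis by simp
  qed
  then show ?thesis
    by (intro summable_comparison_test'[OF summable_mult[OF summable_inverse_square_shifted]])
qed

lemma exponential_series_smooth:
  assumes e: "rapidly_decreasing e"
  defines "\<psi> \<equiv> \<lambda>\<theta>. \<Sum>n. e n * cis (- (real n * \<theta>))"
  shows "\<psi> \<in> smooth_circle" "circle_coeff \<psi> n = of_real (2 * pi) * e n"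
proof -
  define E where "E m n = (- (\<i> * of_nat n)) ^ m * e n" for m n
  have sm: "summable (\<lambda>n. norm (E m n))" for m
    unfolding E_def by (rule rapidly_decreasing_summable[OF e])
  have E_Suc: "E (Suc m) n = - (\<i> * of_nat n) * E m n" for m n
    by (simp add: E_def)
  have "((\<lambda>\<theta>. \<Sum>n. E m n * cis (- (real n * \<theta>))) has_vector_derivative
      (\<Sum>n. E (Suc m) n * cis (- (real n * \<theta>)))) (at \<theta>)" for m \<theta>
    using exponential_series_vector_derivative[OF sm[of m], of \<theta>] sm[of "Suc m"]
    unfolding E_Suc by blast
  moreover have "\<psi> = (\<lambda>\<theta>. \<Sum>n. E 0 n * cis (- (real n * \<theta>)))"
    by (simp add: \<psi>_def E_def)
  moreover have "\<psi> (\<theta> + 2 * pi) = \<psi> \<theta>" for \<theta>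
  proof -
    have "cis (- (real n * (\<theta> + 2 * pi))) = cis (- (real n * \<theta>))" for n
    proof -
      have "cis (- (real n * (\<theta> + 2 * pi))) = cis (- (real n * \<theta>)) * cis (2 * pi * (- real n))"
        by (simp add: cis_mult algebra_simps)
      also have "cis (2 * pi * (- real n)) = 1"
        by (rule cis_multiple_2pi) simp
      finally show ?thesis by simp
    qed
    then show ?thesis by (simp add: \<psi>_def)
  qed
  ultimately show "\<psi> \<in> smooth_circle"
    unfolding smooth_circle_def
    by (intro CollectI conjI exI[of _ "\<lambda>m \<theta>. \<Sum>n. E m n * cis (- (real n * \<theta>))"]) auto
  have sm0: "summable (\<lambda>n. norm (e n))" using sm[of 0] by (simp add: E_def)
  have eq: "(\<lambda>\<theta>. cis (real n * \<theta>) * \<psi> \<theta>) = (\<lambda>\<theta>. \<Sum>k. e k * (cis (real n * \<theta>) * cis (- (real k * \<theta>))))"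
  proof
    fix \<theta>
    have "summable (\<lambda>k. e k * cis (- (real k * \<theta>)))"
      by (rule summable_norm_cancel) (use sm0 in \<open>simp add: norm_mult\<close>)
    then have "cis (real n * \<theta>) * \<psi> \<theta> = (\<Sum>k. cis (real n * \<theta>) * (e k * cis (- (real k * \<theta>))))"
      unfolding \<psi>_def by (rule suminf_mult[symmetric])
    then show "cis (real n * \<theta>) * \<psi> \<theta> = (\<Sum>k. e k * (cis (real n * \<theta>) * cis (- (real k * \<theta>))))"
      by (simp only: mult.left_commute)
  qed
  have cont: "continuous_on {0..2 * pi} (\<lambda>\<theta>. cis (- (real k * \<theta>)))" for k
    using continuous_on_cis_linear[of "{0..2 * pi}" "- real k"] by simp
  have "(\<lambda>k. integral {0..2 * pi} (\<lambda>\<theta>. e k * (cis (real n * \<theta>) * cis (- (real k * \<theta>))))) sums circle_coeff \<psi> n"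
    unfolding circle_coeff_def eq
    by (rule integral_sums_of_dominated_series[OF _ _ sm0])
      (auto intro!: continuous_intros cont simp: norm_mult)
  moreover have "integral {0..2 * pi} (\<lambda>\<theta>. e k * (cis (real n * \<theta>) * cis (- (real k * \<theta>)))) = (if k = n then of_real (2 * pi) * e k else 0)" for k
    unfolding integral_mult_right integral_cis_int_multiple by simp
  ultimately have "(\<lambda>k. if k = n then of_real (2 * pi) * e k else 0) sums circle_coeff \<psi> n" by simp
  then show "circle_coeff \<psi> n = of_real (2 * pi) * e n"
    using sums_single[of n "\<lambda>k. of_real (2 * pi) * e k"] sums_unique2 by blast
qed

text \<open>
  If the bound \<open>(n + 1)\<^sup>m\<close> failed for only finitely many \<open>n\<close>, a larger constant would absorb these
  exceptions. So for every \<open>m\<close> it fails for arbitrarily large \<open>n\<close>, and the exponent can be raised at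
  each step of the subsequence.
\<close>

lemma superpolynomial_subsequence:
  assumes "\<not> polynomially_bounded a"
  obtains \<nu> :: "nat \<Rightarrow> nat" where "strict_mono \<nu>" "\<And>k. norm (a (\<nu> k)) > (real (\<nu> k) + 1) ^ k"
proof -
  have ex: "\<exists>n>N. norm (a n) > (real n + 1) ^ m" for N m
  proof (rule ccontr)
    assume "\<not> ?thesis"
    then have le: "norm (a n) \<le> (real n + 1) ^ m" if "n > N" for n
      using that by (meson not_le)
    define K where "K = 1 + (\<Sum>n\<le>N. norm (a n))"
    have K1: "K \<ge> 1" by (simp add: K_def sum_nonneg)
    have "norm (a n) \<le> K * (real n + 1) ^ m" for n
    proof (cases "n > N")
      case True
      have "(real n + 1) ^ m \<le> K * (real n + 1) ^ m"
        using K1 mult_right_mono[of 1 K "(real n + 1) ^ m"] by simp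
      with le[OF True] show ?thesis by (rule order_trans)
    next
      case False
      then have "norm (a n) \<le> (\<Sum>n\<le>N. norm (a n))" by (intro member_le_sum) auto
      then have "norm (a n) \<le> K * 1" by (simp add: K_def)
      also have "\<dots> \<le> K * (real n + 1) ^ m" using K1 by (intro mult_left_mono) auto
      finally show ?thesis .
    qed
    then show False using assms by (auto simp: polynomially_bounded_def)
  qed
  obtain \<nu> where "\<forall>k. norm (a (\<nu> k)) > (real (\<nu> k) + 1) ^ k \<and> \<nu> k < \<nu> (Suc k)"
    using dependent_nat_choice[of "\<lambda>k n. norm (a n) > (real n + 1) ^ k" "\<lambda>k m n. m < n"] ex by metis
  then show ?thesis by (intro that[of \<nu>]) (auto simp: strict_mono_Suc_iff)
qed

text \<open>
  A condensation argument in place of the uniform boundedness principle for smooth functions on the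
  circle. The coefficients \<open>1 / a\<^sub>n\<close> on the sparse subsequence are below every power of \<open>1 / n\<close>, and
  with them each term of the pairing becomes \<open>2 \<pi> r\<^sup>n\<close>, so no cancellation can occur.
\<close>

lemma diverging_test_function:
  fixes g :: "complex \<Rightarrow> complex"
  assumes g: "\<And>z. norm z < 1 \<Longrightarrow> (\<lambda>n. a n * z ^ n) sums g z" and a: "\<not> polynomially_bounded a"
  obtains \<psi> where "\<psi> \<in> smooth_circle"
    "\<And>L. \<not> ((\<lambda>r. integral {0..2 * pi} (\<lambda>\<theta>. g (rcis r \<theta>) * \<psi> \<theta>)) \<longlongrightarrow> L) (at_left 1)"
proof -
  obtain \<nu> :: "nat \<Rightarrow> nat" where \<nu>: "strict_mono \<nu>" "\<And>k. norm (a (\<nu> k)) > (real (\<nu> k) + 1) ^ k"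
    using superpolynomial_subsequence[OF a] by metis
  define e where "e n = (if n \<in> range \<nu> then inverse (a n) else 0)" for n
  have a_nz: "a (\<nu> k) \<noteq> 0" for k
    using \<nu>(2)[of k] by (metis norm_zero not_less zero_le_power add_nonneg_nonneg of_nat_0_le_iff zero_le_one)
  have "rapidly_decreasing e"
    unfolding rapidly_decreasing_def
  proof
    fix m
    \<comment> \<open>From the \<open>m\<close>-th member of the subsequence on the product is at most 1; the sum covers the earlier ones.\<close>
    define K where "K = 1 + (\<Sum>k<m. norm (e (\<nu> k)) * (real (\<nu> k) + 1) ^ m)"
    have K1: "K \<ge> 1" by (simp add: K_def sum_nonneg)
    have "norm (e n) * (real n + 1) ^ m \<le> K" for n
    proof (cases "n \<in> range \<nu>")
      case False
      then show ?thesis using K1 by (simp add: e_def)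
    next
      case True
      then obtain k where k: "n = \<nu> k" by auto
      show ?thesis
      proof (cases "k < m")
        case True
        then have "norm (e (\<nu> k)) * (real (\<nu> k) + 1) ^ m \<le> (\<Sum>k<m. norm (e (\<nu> k)) * (real (\<nu> k) + 1) ^ m)"
          by (intro member_le_sum[of k "{..<m}" "\<lambda>k. norm (e (\<nu> k)) * (real (\<nu> k) + 1) ^ m"]) auto
        then show ?thesis by (simp add: k K_def)
      next
        case False
        have "(real n + 1) ^ m \<le> (real n + 1) ^ k" using False by (intro power_increasing) auto
        also have "\<dots> \<le> norm (a n)" using \<nu>(2)[of k] k by simp
        finally have "(real n + 1) ^ m \<le> norm (a n)" .
        moreover have "norm (e n) = inverse (norm (a n))" using True by (simp add: e_def norm_inverse)
        ultimately have "norm (e n) * (real n + 1) ^ m \<le> inverse (norm (a n)) * norm (a n)"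
          by (simp add: mult_left_mono)
        also have "\<dots> = 1" using a_nz[of k] k by simp
        finally show ?thesis using K1 by simp
      qed
    qed
    then show "\<exists>K. \<forall>n. norm (e n) * (real n + 1) ^ m \<le> K" by blast
  qed
  define \<psi> where "\<psi> \<theta> = (\<Sum>n. e n * cis (- (real n * \<theta>)))" for \<theta>
  have \<psi>: "\<psi> \<in> smooth_circle" "\<And>n. circle_coeff \<psi> n = of_real (2 * pi) * e n"
    using exponential_series_smooth[OF \<open>rapidly_decreasing e\<close>] unfolding \<psi>_def by auto
  have cont: "continuous_on {0..2 * pi} \<psi>" by (rule smooth_circleE[OF \<psi>(1)]) blast
  let ?P = "\<lambda>r. integral {0..2 * pi} (\<lambda>\<theta>. g (rcis r \<theta>) * \<psi> \<theta>)"
  have lower: "2 * pi * (\<Sum>k<N. r ^ \<nu> k) \<le> norm (?P r)" if r: "0 < r" "r < 1" for r N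
  proof -
    let ?t = "\<lambda>n. 2 * pi * (if n \<in> range \<nu> then r ^ n else 0)"
    have "(\<lambda>n. a n * circle_coeff \<psi> n * of_real r ^ n) sums ?P r"
      by (rule pairing_power_series[OF g cont]) (use r in auto)
    moreover have "(\<lambda>n. a n * circle_coeff \<psi> n * of_real r ^ n) = (\<lambda>n. complex_of_real (?t n))"
      using a_nz by (auto simp: fun_eq_iff \<psi>(2) e_def)
    ultimately have S: "(\<lambda>n. complex_of_real (?t n)) sums ?P r" by simp
    then have sums_Re: "?t sums Re (?P r)" using sums_Re by fastforce
    have "2 * pi * (\<Sum>k<N. r ^ \<nu> k) = (\<Sum>k<N. ?t (\<nu> k))" by (simp add: sum_distrib_left)
    also have "\<dots> = (\<Sum>n\<in>\<nu> ` {..<N}. ?t n)"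
      using \<nu>(1) by (subst sum.reindex) (auto simp: strict_mono_imp_inj_on o_def)
    also have "\<dots> \<le> suminf ?t"
      using r by (intro sum_le_suminf sums_summable[OF sums_Re]) auto
    also have "\<dots> = Re (?P r)" using sums_unique[OF sums_Re] by simp
    also have "\<dots> \<le> norm (?P r)" by (rule complex_Re_le_cmod)
    finally show ?thesis .
  qed
  have "\<not> (?P \<longlongrightarrow> L) (at_left 1)" for L
  proof
    assume L: "(?P \<longlongrightarrow> L) (at_left 1)"
    have "2 * pi * real N \<le> norm L" for N
    proof (rule tendsto_le[OF _ tendsto_norm[OF L]])
      have "((\<lambda>r. 2 * pi * (\<Sum>k<N. r ^ \<nu> k)) \<longlongrightarrow> 2 * pi * (\<Sum>k<N. 1 ^ \<nu> k)) (at_left (1::real))"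
        by (intro tendsto_intros)
      then show "((\<lambda>r. 2 * pi * (\<Sum>k<N. r ^ \<nu> k)) \<longlongrightarrow> 2 * pi * real N) (at_left (1::real))" by simp
      have "\<forall>\<^sub>F r in at_left (1::real). r \<in> {0<..<1}"
        by (rule eventually_at_left_real) simp
      then show "\<forall>\<^sub>F r in at_left 1. 2 * pi * (\<Sum>k<N. r ^ \<nu> k) \<le> norm (?P r)"
        by eventually_elim (use lower in auto)
    qed simp
    moreover obtain N where "real N > norm L / (2 * pi)" using reals_Archimedean2 by blast
    ultimately have "2 * pi * real N \<le> norm L" "norm L < 2 * pi * real N"
      by (auto simp: field_simps)
    then show False by simp
  qed
  then show ?thesis using that \<psi>(1) by blast
qed

section \<open>Boundary values of holomorphic functions\<close>

definition moderate_growth :: "(complex \<Rightarrow> complex) \<Rightarrow> bool" where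
  "moderate_growth g \<longleftrightarrow> (\<exists>C \<alpha>. C > 0 \<and> \<alpha> \<ge> 0 \<and> (\<forall>z\<in>unit_disc. norm (g z) \<le> C / (1 - norm z) powr \<alpha>))"

definition circle_pairings_converge :: "(complex \<Rightarrow> complex) \<Rightarrow> bool" where
  "circle_pairings_converge g \<longleftrightarrow> (\<forall>\<psi>\<in>smooth_circle.
     \<exists>L. ((\<lambda>r. integral {0..2 * pi} (\<lambda>\<theta>. g (rcis r \<theta>) * \<psi> \<theta>)) \<longlongrightarrow> L) (at_left 1))"

theorem holomorphic_boundary_value_iff_moderate_growth:
  assumes hol: "g holomorphic_on unit_disc"
  shows "circle_pairings_converge g \<longleftrightarrow> moderate_growth g"
proof -
  define a where "a n = (deriv ^^ n) g 0 / fact n" for n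
  have g: "(\<lambda>n. a n * z ^ n) sums g z" if "norm z < 1" for z
    using holomorphic_power_series[OF hol, of z] that by (simp add: a_def)
  have "moderate_growth g \<Longrightarrow> polynomially_bounded a"
    unfolding moderate_growth_def a_def using Taylor_coeffs_polynomially_bounded[OF hol] by fastforce
  moreover have "polynomially_bounded a \<Longrightarrow> circle_pairings_converge g"
    unfolding circle_pairings_converge_def using pairing_converges[OF g] by blast
  moreover have "circle_pairings_converge g \<Longrightarrow> polynomially_bounded a"
    unfolding circle_pairings_converge_def using diverging_test_function[OF g] by metis
  moreover have "polynomially_bounded a \<Longrightarrow> moderate_growth g"
  proof -
    assume "polynomially_bounded a"
    then obtain C \<alpha> where "C > 0" "\<alpha> \<ge> 0" "\<And>z. norm z < 1 \<Longrightarrow> norm (g z) \<le> C / (1 - norm z) powr \<alpha>"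
      using power_series_growth[OF g] by metis
    then show ?thesis unfolding moderate_growth_def by (intro exI[of _ C] exI[of _ \<alpha>]) auto
  qed
  ultimately show ?thesis by blast
qed

section \<open>Bicomplex functions and their idempotent components\<close>

lemma bc_component_simps [simp]:
  "bc_plus (u * v) = bc_plus u * bc_plus v" "bc_minus (u * v) = bc_minus u * bc_minus v"
  "bc_plus (u + v) = bc_plus u + bc_plus v" "bc_minus (u + v) = bc_minus u + bc_minus v"
  "bc_plus (r *\<^sub>R u) = r *\<^sub>R bc_plus u" "bc_minus (r *\<^sub>R u) = r *\<^sub>R bc_minus u"
  "bc_plus (bc_of_complex a) = a" "bc_minus (bc_of_complex a) = a"
  "bc_plus bc_j = - \<i>" "bc_minus bc_j = \<i>"
  "bc_plus (bc_exp u) = exp (bc_plus u)" "bc_minus (bc_exp u) = exp (bc_minus u)"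
  "bc_plus 0 = 0" "bc_minus 0 = 0"
proof -
  show "bc_plus (bc_exp u) = exp (bc_plus u)" "bc_minus (bc_exp u) = exp (bc_minus u)"
    unfolding bc_exp_def by (rule bc_idempotent_components)+
qed (simp_all add: bc_plus_def bc_minus_def bc_of_complex_def bc_j_def scaleR_bicomplex_def algebra_simps)

lemma bounded_linear_bc_plus: "bounded_linear bc_plus"
  and bounded_linear_bc_minus: "bounded_linear bc_minus"
  by (intro linear_conv_bounded_linear[THEN iffD1] linearI; simp)+

lemma bounded_linear_p_plus: "bounded_linear (\<lambda>a. p_plus * bc_of_complex a)"
  and bounded_linear_p_minus: "bounded_linear (\<lambda>a. p_minus * bc_of_complex a)"
  by (intro linear_conv_bounded_linear[THEN iffD1] linearI;
      simp add: bicomplex_eq_iff p_plus_minus_coordinates bc_of_complex_def scaleR_bicomplex_def algebra_simps)+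

lemma bc_reconstruct: "p_plus * bc_of_complex (bc_plus u) + p_minus * bc_of_complex (bc_minus u) = u"
  using bicomplex_decomposition[of u] by metis

lemma set_integrable_bicomplex:
  assumes "set_integrable M S (\<lambda>x. bc_plus (f x))" "set_integrable M S (\<lambda>x. bc_minus (f x))"
  shows "set_integrable M S f"
proof -
  have "integrable M (\<lambda>x. p_plus * bc_of_complex (indicator S x *\<^sub>R bc_plus (f x))
      + p_minus * bc_of_complex (indicator S x *\<^sub>R bc_minus (f x)))"
    using assms unfolding set_integrable_def
    by (intro Bochner_Integration.integrable_add integrable_bounded_linear[OF bounded_linear_p_plus]
        integrable_bounded_linear[OF bounded_linear_p_minus])
  moreover have "p_plus * bc_of_complex (indicator S x *\<^sub>R bc_plus (f x))
      + p_minus * bc_of_complex (indicator S x *\<^sub>R bc_minus (f x)) = indicator S x *\<^sub>R f x" for x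
    using bc_reconstruct[of "indicator S x *\<^sub>R f x"] by simp
  ultimately show ?thesis unfolding set_integrable_def by simp
qed

lemma set_integral_bc_components:
  assumes "set_integrable M S f"
  shows "bc_plus (LINT x:S|M. f x) = (LINT x:S|M. bc_plus (f x))"
    "bc_minus (LINT x:S|M. f x) = (LINT x:S|M. bc_minus (f x))"
proof -
  have "integrable M (\<lambda>x. indicator S x *\<^sub>R f x)" using assms by (simp add: set_integrable_def)
  from integral_bounded_linear[OF bounded_linear_bc_plus this] integral_bounded_linear[OF bounded_linear_bc_minus this]
  show "bc_plus (LINT x:S|M. f x) = (LINT x:S|M. bc_plus (f x))"
    "bc_minus (LINT x:S|M. f x) = (LINT x:S|M. bc_minus (f x))"
    by (simp_all add: set_lebesgue_integral_def)
qed

section \<open>Components of weak solutions\<close>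

lemma test_function_derivative:
  assumes "\<psi> \<in> test_functions"
  obtains K where "compact K" "K \<subseteq> unit_disc"
    "\<And>z. (\<psi> has_derivative frechet_derivative \<psi> (at z)) (at z)"
    "\<And>z h. z \<notin> K \<Longrightarrow> frechet_derivative \<psi> (at z) h = 0"
    "\<And>S. continuous_on S (\<lambda>z. frechet_derivative \<psi> (at z) 1)"
    "\<And>S. continuous_on S (\<lambda>z. frechet_derivative \<psi> (at z) \<i>)"
proof -
  obtain d :: "nat \<Rightarrow> nat \<Rightarrow> complex \<Rightarrow> complex" where d: "d 0 0 = \<psi>"
    "\<And>m n z. (d m n has_derivative (\<lambda>h. Re h *\<^sub>R d (Suc m) n z + Im h *\<^sub>R d m (Suc n) z)) (at z)"
    using assms by (auto simp: test_functions_def smooth_plane_def)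
  have cont: "continuous_on S (d m n)" for S m n
    by (intro continuous_at_imp_continuous_on ballI has_derivative_continuous[OF d(2)])
  have fd: "frechet_derivative \<psi> (at z) = (\<lambda>h. Re h *\<^sub>R d (Suc 0) 0 z + Im h *\<^sub>R d 0 (Suc 0) z)" for z
    using frechet_derivative_at[OF d(2)[of 0 0 z]] d(1) by simp
  let ?K = "closure {z. \<psi> z \<noteq> 0}"
  have "frechet_derivative \<psi> (at z) h = 0" if "z \<notin> ?K" for z h
  proof -
    have zero: "0 = \<psi> x" if "x \<in> - ?K" for x
      using that closure_subset[of "{z. \<psi> z \<noteq> 0}"] by auto
    have K: "open (- ?K)" "z \<in> - ?K" using that by auto
    have "(\<psi> has_derivative (\<lambda>_. 0)) (at z)"
      by (rule has_derivative_transform_within_open[OF has_derivative_const K zero])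
    from fun_cong[OF frechet_derivative_at[OF this], of h] show ?thesis by simp
  qed
  moreover have "(\<psi> has_derivative frechet_derivative \<psi> (at z)) (at z)" for z
    using d(2)[of 0 0 z] d(1) fd by simp
  ultimately show ?thesis
    using assms cont by (intro that[of ?K]) (auto simp: test_functions_def fd)
qed

text \<open>
  The derivatives of \<open>\<psi>\<close> are continuous and vanish outside a compact part of the disc, and there \<open>u\<close>
  is bounded.
\<close>

lemma set_integrable_against_test_derivative:
  fixes u :: "complex \<Rightarrow> complex"
  assumes u: "continuous_on unit_disc u" and \<psi>: "\<psi> \<in> test_functions"
  shows "set_integrable lebesgue unit_disc
    (\<lambda>z. u z * (frechet_derivative \<psi> (at z) 1 + c * frechet_derivative \<psi> (at z) \<i>))"
proof -
  obtain K where K: "compact K" "K \<subseteq> unit_disc"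
    "\<And>z h. z \<notin> K \<Longrightarrow> frechet_derivative \<psi> (at z) h = 0"
    "\<And>S. continuous_on S (\<lambda>z. frechet_derivative \<psi> (at z) 1)"
    "\<And>S. continuous_on S (\<lambda>z. frechet_derivative \<psi> (at z) \<i>)"
    by (rule test_function_derivative[OF \<psi>]) (rule that)
  let ?f = "\<lambda>z. u z * (frechet_derivative \<psi> (at z) 1 + c * frechet_derivative \<psi> (at z) \<i>)"
  have "integrable lborel (\<lambda>z. indicator K z *\<^sub>R ?f z)"
    by (rule borel_integrable_compact[OF K(1)])
      (intro continuous_intros K continuous_on_subset[OF u])
  then have "integrable lebesgue (\<lambda>z. indicator K z *\<^sub>R ?f z)"
    by (simp add: integrable_completion borel_measurable_integrable)
  moreover have "indicator K z *\<^sub>R ?f z = indicator unit_disc z *\<^sub>R ?f z" for z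
    using K(2,3) by (cases "z \<in> K") auto
  ultimately show ?thesis by (simp add: set_integrable_def)
qed

lemma real_test_function_derivative:
  assumes \<psi>: "\<psi> \<in> test_functions" and re: "\<And>z. \<psi> z \<in> \<real>"
  shows "cnj (frechet_derivative \<psi> (at z) h) = frechet_derivative \<psi> (at z) h"
proof -
  have d: "(\<psi> has_derivative frechet_derivative \<psi> (at z)) (at z)"
    by (rule test_function_derivative[OF \<psi>])
  then have "((\<lambda>z. cnj (\<psi> z)) has_derivative (\<lambda>h. cnj (frechet_derivative \<psi> (at z) h))) (at z)"
    by (rule bounded_linear.has_derivative[OF bounded_linear_cnj])
  moreover have "(\<lambda>z. cnj (\<psi> z)) = \<psi>" using re by (auto simp: Reals_cnj_iff)
  ultimately have "(\<psi> has_derivative (\<lambda>h. cnj (frechet_derivative \<psi> (at z) h))) (at z)" by simp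
  from has_derivative_unique[OF this d] show ?thesis by metis
qed

text \<open>
  On the minus component the operator \<open>dbar\<close> acts as \<open>\<partial> / \<partial>z\<^sup>*\<close>, on the plus component as \<open>\<partial> / \<partial>z\<close>.
  Conjugating the plus component, against real test functions, turns the second case into the first.
\<close>

theorem Hol_disc_components_holomorphic:
  assumes "\<phi> \<in> Hol_disc"
  shows "(\<lambda>z. bc_minus (\<phi> z)) holomorphic_on unit_disc"
    "(\<lambda>z. cnj (bc_plus (\<phi> z))) holomorphic_on unit_disc"
proof -
  have cont: "continuous_on unit_disc \<phi>" and weak: "has_weak_dbar \<phi> (\<lambda>_. 0)"
    using assms by (auto simp: Hol_disc_def)
  have cp: "continuous_on unit_disc (\<lambda>z. bc_plus (\<phi> z))" and cm: "continuous_on unit_disc (\<lambda>z. bc_minus (\<phi> z))"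
    by (intro bounded_linear.continuous_on[OF bounded_linear_bc_plus]
        bounded_linear.continuous_on[OF bounded_linear_bc_minus] cont)+
  have zero: "(LINT z:unit_disc|lebesgue. bc_plus (\<phi> z) * (frechet_derivative \<psi> (at z) 1 + (- \<i>) * frechet_derivative \<psi> (at z) \<i>)) = 0"
    "(LINT z:unit_disc|lebesgue. bc_minus (\<phi> z) * (frechet_derivative \<psi> (at z) 1 + \<i> * frechet_derivative \<psi> (at z) \<i>)) = 0"
    if \<psi>: "\<psi> \<in> test_functions" for \<psi>
  proof -
    have comp: "bc_plus (\<phi> z * dbar \<psi> z) = 1/2 * (bc_plus (\<phi> z) * (frechet_derivative \<psi> (at z) 1 + (- \<i>) * frechet_derivative \<psi> (at z) \<i>))"
      "bc_minus (\<phi> z * dbar \<psi> z) = 1/2 * (bc_minus (\<phi> z) * (frechet_derivative \<psi> (at z) 1 + \<i> * frechet_derivative \<psi> (at z) \<i>))" for z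
      by (simp_all add: dbar_def)
    have int: "set_integrable lebesgue unit_disc (\<lambda>z. \<phi> z * dbar \<psi> z)"
      by (rule set_integrable_bicomplex; unfold comp;
          intro set_integrable_mult_right set_integrable_against_test_derivative cp cm \<psi>)
    have "(LINT z:unit_disc|lebesgue. \<phi> z * dbar \<psi> z) = 0"
      using weak \<psi> by (simp add: has_weak_dbar_def set_lebesgue_integral_def)
    with set_integral_bc_components[OF int]
    show "(LINT z:unit_disc|lebesgue. bc_plus (\<phi> z) * (frechet_derivative \<psi> (at z) 1 + (- \<i>) * frechet_derivative \<psi> (at z) \<i>)) = 0"
      "(LINT z:unit_disc|lebesgue. bc_minus (\<phi> z) * (frechet_derivative \<psi> (at z) 1 + \<i> * frechet_derivative \<psi> (at z) \<i>)) = 0"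
      unfolding comp set_integral_mult_right by simp_all
  qed
  show "(\<lambda>z. bc_minus (\<phi> z)) holomorphic_on unit_disc"
    by (rule continuous_weak_solution_holomorphic[OF cm])
      (use zero(2) in \<open>auto simp: annihilates_real_test_functions_def\<close>)
  show "(\<lambda>z. cnj (bc_plus (\<phi> z))) holomorphic_on unit_disc"
  proof (rule continuous_weak_solution_holomorphic)
    show "continuous_on unit_disc (\<lambda>z. cnj (bc_plus (\<phi> z)))" by (intro continuous_intros cp)
    show "annihilates_real_test_functions (\<lambda>z. cnj (bc_plus (\<phi> z)))"
      unfolding annihilates_real_test_functions_def
    proof (intro ballI impI)
      fix \<psi> assume \<psi>: "\<psi> \<in> test_functions" and re: "\<forall>\<zeta>. \<psi> \<zeta> \<in> \<real>"
      have "cnj (LINT z:unit_disc|lebesgue. bc_plus (\<phi> z) * (frechet_derivative \<psi> (at z) 1 + (- \<i>) * frechet_derivative \<psi> (at z) \<i>))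
        = (LINT z:unit_disc|lebesgue. cnj (bc_plus (\<phi> z)) * (frechet_derivative \<psi> (at z) 1 + \<i> * frechet_derivative \<psi> (at z) \<i>))"
        unfolding set_lebesgue_integral_def Bochner_Integration.integral_cnj[symmetric]
        by (simp add: real_test_function_derivative[OF \<psi> re[rule_format]])
      then show "(LINT z:unit_disc|lebesgue. cnj (bc_plus (\<phi> z)) * (frechet_derivative \<psi> (at z) 1 + \<i> * frechet_derivative \<psi> (at z) \<i>)) = 0"
        unfolding zero(1)[OF \<psi>] by simp
    qed
  qed
qed

section \<open>Components of boundary values and growth\<close>

lemma smooth_circle_cnj:
  assumes "\<psi> \<in> smooth_circle"
  shows "(\<lambda>\<theta>. cnj (\<psi> \<theta>)) \<in> smooth_circle"
proof -
  obtain d where d: "d 0 = \<psi>" "\<And>n \<theta>. (d n has_vector_derivative d (Suc n) \<theta>) (at \<theta>)"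
    and per: "\<And>\<theta>. \<psi> (\<theta> + 2 * pi) = \<psi> \<theta>"
    using assms by (auto simp: smooth_circle_def)
  have "((\<lambda>\<theta>. cnj (d n \<theta>)) has_vector_derivative cnj (d (Suc n) \<theta>)) (at \<theta>)" for n \<theta>
    by (rule bounded_linear.has_vector_derivative[OF bounded_linear_cnj d(2)])
  then show ?thesis
    using d(1) per unfolding smooth_circle_def
    by (intro CollectI conjI exI[of _ "\<lambda>n \<theta>. cnj (d n \<theta>)"]) auto
qed

lemma circle_pairings_converge_cnj:
  assumes "circle_pairings_converge g"
  shows "circle_pairings_converge (\<lambda>z. cnj (g z))"
  unfolding circle_pairings_converge_def
proof
  fix \<psi> assume \<psi>: "\<psi> \<in> smooth_circle"
  from bspec[OF assms[unfolded circle_pairings_converge_def] smooth_circle_cnj[OF \<psi>]]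
  obtain L where "((\<lambda>r. integral {0..2 * pi} (\<lambda>\<theta>. g (rcis r \<theta>) * cnj (\<psi> \<theta>))) \<longlongrightarrow> L) (at_left 1)"
    by (rule exE)
  then have "((\<lambda>r. cnj (integral {0..2 * pi} (\<lambda>\<theta>. g (rcis r \<theta>) * cnj (\<psi> \<theta>)))) \<longlongrightarrow> cnj L) (at_left 1)"
    by (rule tendsto_cnj)
  then show "\<exists>L. ((\<lambda>r. integral {0..2 * pi} (\<lambda>\<theta>. cnj (g (rcis r \<theta>)) * \<psi> \<theta>)) \<longlongrightarrow> L) (at_left 1)"
    unfolding Henstock_Kurzweil_Integration.integral_cnj by auto
qed

text \<open>
  On a circle of radius \<open>r < 1\<close> all integrands are continuous, hence the integrability clause holds and
  the components of the bicomplex integral are the scalar integrals.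
\<close>

lemma distributional_boundary_value_iff_components:
  assumes "continuous_on unit_disc \<phi>"
  shows "has_distributional_boundary_value \<phi> \<longleftrightarrow>
    circle_pairings_converge (\<lambda>z. bc_plus (\<phi> z)) \<and> circle_pairings_converge (\<lambda>z. bc_minus (\<phi> z))"
proof -
  let ?J = "\<lambda>\<psi> r. LINT \<theta>:{0..2 * pi}|lebesgue. \<phi> (rcis r \<theta>) * bc_of_complex (\<psi> \<theta>)"
  let ?P = "\<lambda>\<psi> r. integral {0..2 * pi} (\<lambda>\<theta>. bc_plus (\<phi> (rcis r \<theta>)) * \<psi> \<theta>)"
  let ?M = "\<lambda>\<psi> r. integral {0..2 * pi} (\<lambda>\<theta>. bc_minus (\<phi> (rcis r \<theta>)) * \<psi> \<theta>)"
  have *: "set_integrable lebesgue {0..2 * pi} (\<lambda>\<theta>. \<phi> (rcis r \<theta>) * bc_of_complex (\<psi> \<theta>)) \<and>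
      bc_plus (?J \<psi> r) = ?P \<psi> r \<and> bc_minus (?J \<psi> r) = ?M \<psi> r"
    if \<psi>: "\<psi> \<in> smooth_circle" and r: "r \<in> {0<..<1}" for \<psi> r
  proof -
    have c\<psi>: "continuous_on {0..2 * pi} \<psi>" by (rule smooth_circleE[OF \<psi>]) blast
    have "continuous_on {0..2 * pi} (rcis r)"
      using continuous_on_cis_linear[of _ 1] unfolding rcis_def by (auto intro!: continuous_intros)
    then have c\<phi>: "continuous_on {0..2 * pi} (\<lambda>\<theta>. \<phi> (rcis r \<theta>))"
      by (rule continuous_on_compose2[OF assms]) (use r in auto)
    have ip: "set_integrable lebesgue {0..2 * pi} (\<lambda>\<theta>. bc_plus (\<phi> (rcis r \<theta>)) * \<psi> \<theta>)"
      and im: "set_integrable lebesgue {0..2 * pi} (\<lambda>\<theta>. bc_minus (\<phi> (rcis r \<theta>)) * \<psi> \<theta>)"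
      unfolding cbox_interval[symmetric]
      by (rule absolutely_integrable_continuous; unfold cbox_interval; intro continuous_on_mult c\<psi>
          bounded_linear.continuous_on[OF bounded_linear_bc_plus c\<phi>]
          bounded_linear.continuous_on[OF bounded_linear_bc_minus c\<phi>])+
    have i: "set_integrable lebesgue {0..2 * pi} (\<lambda>\<theta>. \<phi> (rcis r \<theta>) * bc_of_complex (\<psi> \<theta>))"
      by (rule set_integrable_bicomplex) (use ip im in simp_all)
    with set_integral_bc_components[OF i] show ?thesis
      by (simp add: set_lebesgue_integral_eq_integral(2)[OF ip] set_lebesgue_integral_eq_integral(2)[OF im])
  qed
  have near: "\<forall>\<^sub>F r in at_left (1::real). r \<in> {0<..<1}"
    by (rule eventually_at_left_real) simp
  have int: "\<forall>\<^sub>F r in at_left 1. set_integrable lebesgue {0..2 * pi} (\<lambda>\<theta>. \<phi> (rcis r \<theta>) * bc_of_complex (\<psi> \<theta>))"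
    if "\<psi> \<in> smooth_circle" for \<psi>
    using near by eventually_elim (use *[OF that] in blast)
  have iff: "(\<exists>L. (?J \<psi> \<longlongrightarrow> L) (at_left 1)) \<longleftrightarrow> (\<exists>L. (?P \<psi> \<longlongrightarrow> L) (at_left 1)) \<and> (\<exists>L. (?M \<psi> \<longlongrightarrow> L) (at_left 1))"
    if \<psi>: "\<psi> \<in> smooth_circle" for \<psi>
  proof (intro iffI; elim exE conjE)
    fix L assume L: "(?J \<psi> \<longlongrightarrow> L) (at_left 1)"
    have ev: "\<forall>\<^sub>F r in at_left 1. bc_plus (?J \<psi> r) = ?P \<psi> r" "\<forall>\<^sub>F r in at_left 1. bc_minus (?J \<psi> r) = ?M \<psi> r"
      using near by (eventually_elim, use *[OF \<psi>] in blast)+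
    show "(\<exists>L. (?P \<psi> \<longlongrightarrow> L) (at_left 1)) \<and> (\<exists>L. (?M \<psi> \<longlongrightarrow> L) (at_left 1))"
    proof
      show "\<exists>L. (?P \<psi> \<longlongrightarrow> L) (at_left 1)"
        by (rule exI) (rule Lim_transform_eventually[OF bounded_linear.tendsto[OF bounded_linear_bc_plus L] ev(1)])
      show "\<exists>L. (?M \<psi> \<longlongrightarrow> L) (at_left 1)"
        by (rule exI) (rule Lim_transform_eventually[OF bounded_linear.tendsto[OF bounded_linear_bc_minus L] ev(2)])
    qed
  next
    fix L1 L2 assume L: "(?P \<psi> \<longlongrightarrow> L1) (at_left 1)" "(?M \<psi> \<longlongrightarrow> L2) (at_left 1)"
    have "((\<lambda>r. p_plus * bc_of_complex (?P \<psi> r) + p_minus * bc_of_complex (?M \<psi> r)) \<longlongrightarrow>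
      p_plus * bc_of_complex L1 + p_minus * bc_of_complex L2) (at_left 1)"
      by (intro tendsto_add bounded_linear.tendsto[OF bounded_linear_p_plus]
          bounded_linear.tendsto[OF bounded_linear_p_minus] L)
    moreover have "\<forall>\<^sub>F r in at_left 1. p_plus * bc_of_complex (?P \<psi> r) + p_minus * bc_of_complex (?M \<psi> r) = ?J \<psi> r"
      using near
    proof eventually_elim
      case (elim r)
      with *[OF \<psi> elim] bc_reconstruct[of "?J \<psi> r"] show ?case by simp
    qed
    ultimately show "\<exists>L. (?J \<psi> \<longlongrightarrow> L) (at_left 1)"
      by (intro exI) (rule Lim_transform_eventually)
  qed
  show ?thesis
    unfolding has_distributional_boundary_value_def circle_pairings_converge_def
    using int iff by blast
qed

lemma moderate_growth_mono:
  assumes "moderate_growth h" "B > 0" "\<And>z. z \<in> unit_disc \<Longrightarrow> norm (g z) \<le> B * norm (h z)"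
  shows "moderate_growth g"
proof -
  obtain C \<alpha> where C: "C > 0" "\<alpha> \<ge> 0" "\<And>z. z \<in> unit_disc \<Longrightarrow> norm (h z) \<le> C / (1 - norm z) powr \<alpha>"
    using assms(1) unfolding moderate_growth_def by blast
  have "norm (g z) \<le> (B * C) / (1 - norm z) powr \<alpha>" if z: "z \<in> unit_disc" for z
  proof -
    have "norm (g z) \<le> B * norm (h z)" by (rule assms(3)[OF z])
    also have "\<dots> \<le> B * (C / (1 - norm z) powr \<alpha>)"
      using C(3)[OF z] assms(2) by (intro mult_left_mono) auto
    finally show ?thesis by simp
  qed
  then show ?thesis
    unfolding moderate_growth_def using C(1,2) assms(2)
    by (intro exI[of _ "B * C"] exI[of _ \<alpha>]) auto
qed

lemma norm_bc_le: "norm u \<le> cmod (bc_plus u) + cmod (bc_minus u)"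
proof (rule power2_le_imp_le)
  have "(norm u)\<^sup>2 = ((cmod (bc_plus u))\<^sup>2 + (cmod (bc_minus u))\<^sup>2) / 2"
    unfolding norm_bicomplex_def by simp
  also have "\<dots> \<le> (cmod (bc_plus u))\<^sup>2 + (cmod (bc_minus u))\<^sup>2"
  proof -
    have "(x + y) / 2 \<le> x + y" if "x \<ge> 0" "y \<ge> 0" for x y :: real using that by simp
    then show ?thesis by simp
  qed
  also have "\<dots> \<le> (cmod (bc_plus u) + cmod (bc_minus u))\<^sup>2"
    by (simp add: power2_sum)
  finally show "(norm u)\<^sup>2 \<le> (cmod (bc_plus u) + cmod (bc_minus u))\<^sup>2" .
qed simp

lemma norm_growth_iff_components:
  "(\<exists>C \<alpha> :: real. C > 0 \<and> \<alpha> \<ge> 0 \<and>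
      (\<forall>r \<theta>. 0 \<le> r \<and> r < 1 \<longrightarrow> norm (w (rcis r \<theta>)) \<le> C / (1 - r) powr \<alpha>)) \<longleftrightarrow>
    moderate_growth (\<lambda>z. bc_plus (w z)) \<and> moderate_growth (\<lambda>z. bc_minus (w z))"
    (is "?L \<longleftrightarrow> ?R")
proof
  assume ?L
  then obtain C \<alpha> :: real where C: "C > 0" "\<alpha> \<ge> 0"
    and bound: "\<And>r \<theta>. 0 \<le> r \<Longrightarrow> r < 1 \<Longrightarrow> norm (w (rcis r \<theta>)) \<le> C / (1 - r) powr \<alpha>" by blast
  have w: "norm (w z) \<le> C / (1 - norm z) powr \<alpha>" if "z \<in> unit_disc" for z
    using bound[of "cmod z" "Arg z"] that by (simp add: rcis_cmod_Arg)
  have "cmod (bc_plus (w z)) \<le> (2 * C) / (1 - norm z) powr \<alpha>"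
    "cmod (bc_minus (w z)) \<le> (2 * C) / (1 - norm z) powr \<alpha>" if "z \<in> unit_disc" for z
    using cmod_bc_le[of "w z"] w[OF that] by auto
  then show ?R
    unfolding moderate_growth_def using C
    by (intro conjI; intro exI[of _ "2 * C"] exI[of _ \<alpha>]) auto
next
  assume ?R
  then obtain C1 \<alpha>1 C2 \<alpha>2 where C: "C1 > 0" "\<alpha>1 \<ge> 0" "C2 > 0" "\<alpha>2 \<ge> 0"
    and b1: "\<And>z. z \<in> unit_disc \<Longrightarrow> cmod (bc_plus (w z)) \<le> C1 / (1 - norm z) powr \<alpha>1"
    and b2: "\<And>z. z \<in> unit_disc \<Longrightarrow> cmod (bc_minus (w z)) \<le> C2 / (1 - norm z) powr \<alpha>2"
    unfolding moderate_growth_def by blast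
  \<comment> \<open>Powers of \<open>1 - r\<close>, which lies in \<open>(0, 1]\<close>, only decrease when the exponent grows.\<close>
  define \<alpha> where "\<alpha> = max \<alpha>1 \<alpha>2"
  have "norm (w (rcis r \<theta>)) \<le> (C1 + C2) / (1 - r) powr \<alpha>" if r: "0 \<le> r" "r < 1" for r \<theta>
  proof -
    have z: "rcis r \<theta> \<in> unit_disc" and nz: "norm (rcis r \<theta>) = r" using r by auto
    have "norm (w (rcis r \<theta>)) \<le> C1 / (1 - r) powr \<alpha>1 + C2 / (1 - r) powr \<alpha>2"
      using norm_bc_le[of "w (rcis r \<theta>)"] b1[OF z] b2[OF z] unfolding nz by linarith
    also have "\<dots> \<le> C1 / (1 - r) powr \<alpha> + C2 / (1 - r) powr \<alpha>"
      using r C by (intro add_mono divide_left_mono powr_mono' mult_pos_pos) (auto simp: \<alpha>_def)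
    finally show ?thesis by (simp add: add_divide_distrib)
  qed
  then show ?L
    using C by (intro exI[of _ "C1 + C2"] exI[of _ \<alpha>]) (auto simp: \<alpha>_def)
qed

section \<open>Boundary values and growth of generalized analytic functions\<close>

theorem proposition4p17:
  fixes A w \<phi> :: "complex \<Rightarrow> bicomplex" and q :: real
  assumes "q > 2"
    and "A \<in> Lq_disc q"
    and "w \<in> H_A0 A"
    and "\<phi> \<in> Hol_disc"
    and "\<forall>z\<in>unit_disc. w z = \<phi> z * bc_exp (theodorescu A z)"
  shows "has_distributional_boundary_value \<phi> \<longleftrightarrow>
    (\<exists>C \<alpha> :: real. C > 0 \<and> \<alpha> \<ge> 0 \<and>
       (\<forall>r \<theta>. 0 \<le> r \<and> r < 1 \<longrightarrow> norm (w (rcis r \<theta>)) \<le> C / (1 - r) powr \<alpha>))"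
proof -
  obtain M where M: "\<And>z. z \<in> unit_disc \<Longrightarrow> cmod (bc_plus (theodorescu A z)) \<le> M"
    "\<And>z. z \<in> unit_disc \<Longrightarrow> cmod (bc_minus (theodorescu A z)) \<le> M"
    by (rule theodorescu_bounded[OF assms(1,2)]) (rule that)
  have exp_bounds: "cmod (a * exp t) \<le> exp M * cmod a \<and> cmod a \<le> exp M * cmod (a * exp t)"
    if "cmod t \<le> M" for a t
  proof -
    have "\<bar>Re t\<bar> \<le> M" using abs_Re_le_cmod[of t] that by linarith
    then have "exp (Re t) \<le> exp M" "1 \<le> exp (M + Re t)" by auto
    then have "cmod a * exp (Re t) \<le> cmod a * exp M" "cmod a * 1 \<le> cmod a * exp (M + Re t)"
      by (intro mult_left_mono; simp)+
    then show ?thesis by (simp add: norm_mult exp_add mult_ac)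
  qed
  have w: "bc_plus (w z) = bc_plus (\<phi> z) * exp (bc_plus (theodorescu A z))"
    "bc_minus (w z) = bc_minus (\<phi> z) * exp (bc_minus (theodorescu A z))" if "z \<in> unit_disc" for z
    using assms(5) that by simp_all
  have comparable: "moderate_growth g \<longleftrightarrow> moderate_growth h"
    if "\<And>z. z \<in> unit_disc \<Longrightarrow> cmod (g z) \<le> exp M * cmod (h z) \<and> cmod (h z) \<le> exp M * cmod (g z)" for g h
    using that moderate_growth_mono[of h "exp M" g] moderate_growth_mono[of g "exp M" h] by auto
  have growth: "moderate_growth (\<lambda>z. bc_plus (w z)) \<longleftrightarrow> moderate_growth (\<lambda>z. cnj (bc_plus (\<phi> z)))"
    "moderate_growth (\<lambda>z. bc_minus (w z)) \<longleftrightarrow> moderate_growth (\<lambda>z. bc_minus (\<phi> z))"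
  proof -
    show "moderate_growth (\<lambda>z. bc_plus (w z)) \<longleftrightarrow> moderate_growth (\<lambda>z. cnj (bc_plus (\<phi> z)))"
      by (rule comparable) (simp only: w complex_mod_cnj exp_bounds[OF M(1)])
    show "moderate_growth (\<lambda>z. bc_minus (w z)) \<longleftrightarrow> moderate_growth (\<lambda>z. bc_minus (\<phi> z))"
      by (rule comparable) (simp only: w exp_bounds[OF M(2)])
  qed
  have cnj_iff: "circle_pairings_converge (\<lambda>z. bc_plus (\<phi> z)) \<longleftrightarrow> circle_pairings_converge (\<lambda>z. cnj (bc_plus (\<phi> z)))"
    using circle_pairings_converge_cnj[of "\<lambda>z. bc_plus (\<phi> z)"]
      circle_pairings_converge_cnj[of "\<lambda>z. cnj (bc_plus (\<phi> z))"] by auto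
  have plus: "circle_pairings_converge (\<lambda>z. bc_plus (\<phi> z)) \<longleftrightarrow> moderate_growth (\<lambda>z. bc_plus (w z))"
    unfolding growth cnj_iff
    by (rule holomorphic_boundary_value_iff_moderate_growth[OF Hol_disc_components_holomorphic(2)[OF assms(4)]])
  have minus: "circle_pairings_converge (\<lambda>z. bc_minus (\<phi> z)) \<longleftrightarrow> moderate_growth (\<lambda>z. bc_minus (w z))"
    unfolding growth
    by (rule holomorphic_boundary_value_iff_moderate_growth[OF Hol_disc_components_holomorphic(1)[OF assms(4)]])
  have "continuous_on unit_disc \<phi>" using assms(4) by (simp add: Hol_disc_def)
  then show ?thesis
    unfolding norm_growth_iff_components plus[symmetric] minus[symmetric]
    by (rule distributional_boundary_value_iff_components)
qed

end
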